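(* Let $N\in\mathbb N$, $\tau\in(0,1/2)$, $\delta=\tau N$, $\lambda\ge 0$, $L=N(1+\lambda)$, $m\in\mathbb N\setminus\{1\}$, and $f\in\mathcal B_\delta(\mathbb R)$. Let $\varphi_{\mathrm{Gauss}}(x)=\mathrm e^{-x^2/(2\sigma^2)}$, $x\in\mathbb R$, with $\sigma=\sqrt{\frac{m}{\pi L(L-2\delta)}}$, and let $R_{\mathrm{Gauss},m}f$ be the corresponding regularized Shannon sampling formula with localized sampling. Then $$\|f-R_{\mathrm{Gauss},m}f\|_{C_0(\mathbb R)}\le\frac{2\sqrt{\pi\delta L}+L(m+1)/\sqrt m}{\pi\sqrt{m\pi(L-2\delta)}}\;\mathrm e^{-\pi m(L/2-\delta)/L}\;\|f\|_{L^2(\mathbb R)}.$$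
   Context: Fourier transform: $\hat f(v)=\int_{\mathbb R}f(t)\,\mathrm e^{-2\pi\mathrm i tv}\,\mathrm dt$ (extended to $L^2(\mathbb R)$ by Plancherel). $\mathrm{sinc}\,x=\frac{\sin x}{x}$ for $x\ne0$ and $\mathrm{sinc}\,0=1$. $\|g\|_{C_0(\mathbb R)}:=\max_{t\in\mathbb R}|g(t)|$. Paley--Wiener space: $\mathcal B_\delta(\mathbb R)=\{f\in L^2(\mathbb R):\ \mathrm{supp}\,\hat f\subseteq[-\delta,\delta]\}$; each element is identified with its smooth representative, so point values make sense. The regularized Shannon sampling formula with localized sampling for the Gaussian window is $$(R_{\mathrm{Gauss},m}f)(t)=\sum_{\ell\in\mathbb Z}f\big(\tfrac{\ell}{L}\big)\,\mathrm{sinc}\big(L\pi(t-\tfrac{\ell}{L})\big)\,\varphi_{\mathrm{Gauss}}\big(t-\tfrac{\ell}{L}\big)\,\mathbf 1_{[-m/L,m/L]}\big(t-\tfrac{\ell}{L}\big),\quad t\in\mathbb R,$$ where $\mathbf 1_{[-m/L,m/L]}$ is the indicator function of $[-m/L,m/L]$. *)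

theory Defs
  imports "HOL-Probability.Probability"
begin

(* Functions are Borel measurable and integrated against lborel; every class in
   the Lebesgue space has a Borel representative. *)
definition in_L2 :: "(real \<Rightarrow> complex) \<Rightarrow> bool" where
  "in_L2 f \<longleftrightarrow> f \<in> borel_measurable borel \<and> integrable lborel (\<lambda>t. (cmod (f t))\<^sup>2)"

definition L2_norm :: "(real \<Rightarrow> complex) \<Rightarrow> real" where
  "L2_norm f = sqrt (LINT t|lborel. (cmod (f t))\<^sup>2)"

(* Membership in L2 is part of convergence, so that no Bochner integral below is
   the default value 0 of a divergent one. *)
definition L2_tendsto :: "(nat \<Rightarrow> real \<Rightarrow> complex) \<Rightarrow> (real \<Rightarrow> complex) \<Rightarrow> bool" where
  "L2_tendsto F f \<longleftrightarrow> (\<forall>n. in_L2 (F n)) \<and> in_L2 f \<and> (\<lambda>n. L2_norm (\<lambda>t. F n t - f t)) \<longlonglongrightarrow> 0"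

definition fourier_L1 :: "(real \<Rightarrow> complex) \<Rightarrow> real \<Rightarrow> complex" where
  "fourier_L1 f v = (LINT t|lborel. f t * exp (- (2 * of_real pi * \<i> * of_real t * of_real v)))"

(* Plancherel: the L2 transform is the continuous extension of the integral
   transform from the dense subspace of functions in both L1 and L2.  It is
   determined only up to null sets, hence a relation: "g represents the
   transform of f". *)
definition has_fourier_L2 :: "(real \<Rightarrow> complex) \<Rightarrow> (real \<Rightarrow> complex) \<Rightarrow> bool" where
  "has_fourier_L2 f g \<longleftrightarrow>
     (\<exists>F. (\<forall>n. integrable lborel (F n)) \<and> L2_tendsto F f \<and> L2_tendsto (\<lambda>n. fourier_L1 (F n)) g)"

(* The support of a class of functions: the complement of the largest open set on
   which the function vanishes almost everywhere. *)
definition ess_support :: "(real \<Rightarrow> complex) \<Rightarrow> real set" where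
  "ess_support g = - \<Union>{U. open U \<and> (AE v in lborel. v \<in> U \<longrightarrow> g v = 0)}"

definition smooth :: "(real \<Rightarrow> complex) \<Rightarrow> bool" where
  "smooth f \<longleftrightarrow>
     (\<forall>k t. ((\<lambda>g x. vector_derivative g (at x)) ^^ k) f differentiable (at t))"

(* Elements are the smooth representatives, so point values are meaningful. *)
definition Paley_Wiener :: "real \<Rightarrow> (real \<Rightarrow> complex) set" where
  "Paley_Wiener \<delta> =
     {f. smooth f \<and> in_L2 f \<and> (\<exists>g. has_fourier_L2 f g \<and> ess_support g \<subseteq> {-\<delta>..\<delta>})}"

definition gauss_window :: "real \<Rightarrow> real \<Rightarrow> real" where
  "gauss_window \<sigma> x = exp (- x\<^sup>2 / (2 * \<sigma>\<^sup>2))"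

definition reg_shannon ::
  "(real \<Rightarrow> real) \<Rightarrow> real \<Rightarrow> nat \<Rightarrow> (real \<Rightarrow> complex) \<Rightarrow> real \<Rightarrow> complex" where
  "reg_shannon \<phi> L m f t =
     (\<Sum>\<^sub>\<infinity>l\<in>(UNIV :: int set).
        f (of_int l / L) *
        of_real (sinc (L * pi * (t - of_int l / L)) * \<phi> (t - of_int l / L) *
                 indicator {- (real m / L)..real m / L} (t - of_int l / L)))"

definition C0_space :: "(real \<Rightarrow> complex) set" where
  "C0_space = {g. continuous_on UNIV g \<and> (g \<longlongrightarrow> 0) at_infinity}"

(* The maximum of the modulus; it exists for elements of C0_space. *)
definition C0_norm :: "(real \<Rightarrow> complex) \<Rightarrow> real" where
  "C0_norm g = (GREATEST M. \<exists>t. M = cmod (g t))"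

end

theory Submission
  imports Defs "HOL-Complex_Analysis.Complex_Analysis"
begin

text \<open>
  A band-limited \<open>f\<close> is the inverse transform \<open>f t = \<integral> g v * cis (2 * pi * t * v)\<close> of a square-integrable \<open>g\<close>
  that lives on \<open>{- \<delta>..\<delta>}\<close> and has the same norm as \<open>f\<close> (\<open>Paley_Wiener_inversion\<close>).  Both facts come from
  one identity, \<open>\<integral> g h = \<integral> f H\<close> with \<open>H\<close> the transform of \<open>h\<close>, which survives the passage to limits: a modulated
  Gaussian \<open>h\<close> yields the inversion formula and the conjugate of \<open>g\<close> yields the equality of norms.  Since
  sampling is linear, the error at \<open>t\<close> is then \<open>g\<close> integrated against the error made on the
  exponential \<open>v \<mapsto> cis (2 * pi * t * v)\<close>, and Cauchy-Schwarz leaves two norms to estimate.  Put \<open>x = L * t\<close>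
  and \<open>s = \<sigma> * L\<close>, so that the samples sit at the integers.

  The first norm is the error of the series that is regularized but not truncated.  For the product \<open>E\<close> of
  an exponential and a Gaussian centred at \<open>x\<close>, the function \<open>E z / ((z - x) * sin (pi * z))\<close> has residues that reproduce
  \<open>E x\<close> and the terms of the sinc series.  The error is therefore a contour integral over a rectangle
  (\<open>sinc_interpolation_remainder\<close>).  The vertical sides disappear as the rectangle widens.  On the horizontal
  sides at height \<open>\<plusminus> Y\<close> the integrand is a Gaussian divided by \<open>Y * sinh (pi * Y)\<close>, which gives a bound of
  the form \<open>C * (exp (k * v) + exp (- (k * v)))\<close> in the frequency \<open>v\<close> (\<open>gaussian_sinc_kernel_bound\<close>).  With the given \<open>\<sigma>\<close>
  the height \<open>Y = m\<close> minimizes the exponent at the band edge, and the exponent is then exactly the one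
  claimed.  It matters that the bound is kept as a function of \<open>v\<close>: it is large only near the edges of
  the band, so its norm in the space of square-integrable functions stays bounded when the band is wide,
  whereas its maximum times \<open>sqrt (2 * \<delta>)\<close> would be too big for the constants of the theorem.

  The second norm belongs to the omitted samples, those with \<open>\<bar>x - l\<bar> > m\<close>.  Exponentials with integer
  frequencies are orthogonal over a period, so the norm is a sum of squares of sinc times Gaussian.
  The squared sinc is at most \<open>1 / (pi * m)\<^sup>2\<close>, and the Gaussians on both sides of \<open>x\<close> are dominated
  by geometric series.  The nearest omitted integers to the left and to the right cannot both be close to
  distance \<open>m\<close>, and using this makes the sum about half as large as two separate estimates would
  (\<open>gaussian_far_sum_le\<close>).

  What remains is an inequality between elementary functions of \<open>m\<close> and \<open>\<delta> / L\<close> (\<open>gauss_shannon_constants\<close>).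
  It is tight enough for \<open>m = 2\<close> that both savings above are used.
\<close>

section \<open>Square-integrable functions\<close>

lemma in_L2D:
  assumes "in_L2 f"
  shows "f \<in> borel_measurable borel" "integrable lborel (\<lambda>t. (cmod (f t))\<^sup>2)"
  using assms by (auto simp: in_L2_def)

lemma L2_norm_nonneg: "0 \<le> L2_norm f"
  by (simp add: L2_norm_def)

lemma L2_norm_power2: "(L2_norm f)\<^sup>2 = (LINT t|lborel. (cmod (f t))\<^sup>2)"
  by (simp add: L2_norm_def)

lemma integrable_norm_mult_in_L2:
  assumes "in_L2 f" "in_L2 g"
  shows "integrable lborel (\<lambda>t. cmod (f t) * cmod (g t))"
proof (rule Bochner_Integration.integrable_bound)
  show "integrable lborel (\<lambda>t. (cmod (f t))\<^sup>2 + (cmod (g t))\<^sup>2)"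
    using assms by (auto dest: in_L2D)
  note [measurable] = assms[THEN in_L2D(1)]
  show "(\<lambda>t. cmod (f t) * cmod (g t)) \<in> borel_measurable lborel"
    by measurable
  have "a * b \<le> a\<^sup>2 + b\<^sup>2" for a b :: real
    using sum_squares_bound[of a b] zero_le_power2[of a] zero_le_power2[of b] by linarith
  then show "AE t in lborel. norm (cmod (f t) * cmod (g t)) \<le> norm ((cmod (f t))\<^sup>2 + (cmod (g t))\<^sup>2)"
    by simp
qed

lemma integrable_mult_in_L2:
  assumes "in_L2 f" "in_L2 g"
  shows "integrable lborel (\<lambda>t. f t * g t)"
proof -
  note [measurable] = assms[THEN in_L2D(1)]
  show ?thesis
    by (rule Bochner_Integration.integrable_bound[OF integrable_norm_mult_in_L2[OF assms]])
      (auto simp: norm_mult)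
qed

text \<open>
  The inequality for nonnegative extended integrals transfers to real integrals because square integrability
  makes all of them finite.
\<close>
lemma L2_Cauchy_Schwarz_norm:
  assumes "in_L2 f" "in_L2 g"
  shows "(LINT t|lborel. cmod (f t) * cmod (g t)) \<le> L2_norm f * L2_norm g"
proof -
  note [measurable] = assms[THEN in_L2D(1)]
  let ?J = "LINT t|lborel. cmod (f t) * cmod (g t)"
  have "(\<integral>\<^sup>+t. ennreal (cmod (f t)) * ennreal (cmod (g t)) \<partial>lborel)\<^sup>2
     \<le> (\<integral>\<^sup>+t. ennreal (cmod (f t)) ^ 2 \<partial>lborel) * (\<integral>\<^sup>+t. ennreal (cmod (g t)) ^ 2 \<partial>lborel)"
    by (rule Cauchy_Schwarz_nn_integral) auto
  also have "(\<integral>\<^sup>+t. ennreal (cmod (f t)) * ennreal (cmod (g t)) \<partial>lborel) = ennreal ?J"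
    by (subst nn_integral_eq_integral[symmetric])
      (auto simp: ennreal_mult intro: integrable_norm_mult_in_L2 assms)
  also have "(\<integral>\<^sup>+t. ennreal (cmod (f t)) ^ 2 \<partial>lborel) = ennreal ((L2_norm f)\<^sup>2)"
    unfolding L2_norm_power2
    by (subst nn_integral_eq_integral[symmetric]) (auto simp: ennreal_power in_L2D assms)
  also have "(\<integral>\<^sup>+t. ennreal (cmod (g t)) ^ 2 \<partial>lborel) = ennreal ((L2_norm g)\<^sup>2)"
    unfolding L2_norm_power2
    by (subst nn_integral_eq_integral[symmetric]) (auto simp: ennreal_power in_L2D assms)
  finally have "?J\<^sup>2 \<le> (L2_norm f * L2_norm g)\<^sup>2"
    by (simp add: ennreal_power power_mult_distrib flip: ennreal_mult)
  then show ?thesis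
    by (rule power2_le_imp_le) (simp add: L2_norm_nonneg)
qed

lemma L2_Cauchy_Schwarz:
  assumes "in_L2 f" "in_L2 g"
  shows "cmod (LINT t|lborel. f t * g t) \<le> L2_norm f * L2_norm g"
  using integral_norm_bound[of lborel "\<lambda>t. f t * g t"] L2_Cauchy_Schwarz_norm[OF assms]
  by (simp add: norm_mult)

lemma in_L2_diff:
  assumes "in_L2 f" "in_L2 g"
  shows "in_L2 (\<lambda>t. f t - g t)"
  unfolding in_L2_def
proof
  note [measurable] = assms[THEN in_L2D(1)]
  show "(\<lambda>t. f t - g t) \<in> borel_measurable borel" by measurable
  show "integrable lborel (\<lambda>t. (cmod (f t - g t))\<^sup>2)"
  proof (rule Bochner_Integration.integrable_bound)
    show "integrable lborel (\<lambda>t. 2 * (cmod (f t))\<^sup>2 + 2 * (cmod (g t))\<^sup>2)"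
      by (intro Bochner_Integration.integrable_add integrable_mult_right in_L2D(2) assms)
    have "(cmod (a - b))\<^sup>2 \<le> 2 * (cmod a)\<^sup>2 + 2 * (cmod b)\<^sup>2" for a b
    proof -
      have "(cmod (a - b))\<^sup>2 \<le> (cmod a + cmod b)\<^sup>2"
        by (intro power_mono norm_triangle_ineq4) auto
      also have "\<dots> \<le> 2 * (cmod a)\<^sup>2 + 2 * (cmod b)\<^sup>2"
        using sum_squares_bound[of "cmod a" "cmod b"] by (simp add: power2_sum)
      finally show ?thesis .
    qed
    then show "AE t in lborel. norm ((cmod (f t - g t))\<^sup>2) \<le> norm (2 * (cmod (f t))\<^sup>2 + 2 * (cmod (g t))\<^sup>2)"
      by simp
  qed simp
qed

lemma in_L2_bounded_integrable:
  assumes h: "integrable lborel h" and B: "\<And>t. cmod (h t) \<le> B"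
  shows "in_L2 h"
  unfolding in_L2_def
proof
  have [measurable]: "h \<in> borel_measurable borel"
    using borel_measurable_integrable[OF h] by simp
  show "h \<in> borel_measurable borel" by fact
  show "integrable lborel (\<lambda>t. (cmod (h t))\<^sup>2)"
  proof (rule Bochner_Integration.integrable_bound)
    show "integrable lborel (\<lambda>t. B * cmod (h t))" using h by simp
    have "(cmod (h t))\<^sup>2 \<le> B * cmod (h t)" for t
      unfolding power2_eq_square by (intro mult_right_mono B) auto
    then show "AE t in lborel. norm ((cmod (h t))\<^sup>2) \<le> norm (B * cmod (h t))"
      by (auto intro: order_trans[OF _ abs_ge_self])
  qed measurable
qed

text \<open>
  Pairing with a fixed square-integrable function is continuous.  This is how identities for integral
  transforms are carried over to the limits that define the transform of a square-integrable function.
\<close>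
lemma L2_tendsto_pairing:
  assumes F: "L2_tendsto F f" and h: "in_L2 h"
  shows "(\<lambda>n. LINT t|lborel. F n t * h t) \<longlonglongrightarrow> (LINT t|lborel. f t * h t)"
proof -
  have Fn: "in_L2 (F n)" and f: "in_L2 f"
    and lim: "(\<lambda>n. L2_norm (\<lambda>t. F n t - f t)) \<longlonglongrightarrow> 0" for n
    using F by (auto simp: L2_tendsto_def)
  have "cmod ((LINT t|lborel. F n t * h t) - (LINT t|lborel. f t * h t))
     \<le> L2_norm (\<lambda>t. F n t - f t) * L2_norm h" for n
    using L2_Cauchy_Schwarz[OF in_L2_diff[OF Fn f] h, of n]
    by (simp add: left_diff_distrib integrable_mult_in_L2 Fn f h)
  then have "(\<lambda>n. (LINT t|lborel. F n t * h t) - (LINT t|lborel. f t * h t)) \<longlonglongrightarrow> 0"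
    by (intro Lim_null_comparison[OF _ tendsto_mult_left_zero[OF lim, of "L2_norm h"]]) auto
  then show ?thesis by (simp add: LIM_zero_iff)
qed

section \<open>Fourier inversion for band-limited functions\<close>

lemma borel_measurable_cis [measurable]: "cis \<in> borel_measurable borel"
  by (intro borel_measurable_continuous_onI continuous_intros)

lemma fourier_L1_cis: "fourier_L1 f v = (LINT t|lborel. f t * cis (- (2 * pi * t * v)))"
  unfolding fourier_L1_def cis_conv_exp by (simp add: mult_ac)

text \<open>
  The kernel \<open>cis (- (2 * pi * t * v))\<close> is symmetric in its two arguments, so this is Fubini's theorem.
\<close>
lemma fourier_L1_multiplication:
  assumes F: "integrable lborel F" and h: "integrable lborel h"
  shows "(LINT v|lborel. fourier_L1 F v * h v) = (LINT t|lborel. F t * fourier_L1 h t)"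
proof -
  have [measurable]: "F \<in> borel_measurable borel" "h \<in> borel_measurable borel"
    using assms by (auto dest: borel_measurable_integrable)
  let ?K = "\<lambda>t v. F t * (h v * cis (- (2 * pi * t * v)))"
  have "integrable (lborel \<Otimes>\<^sub>M lborel) (case_prod ?K)"
  proof (rule lborel_pair.Fubini_integrable)
    show "case_prod ?K \<in> borel_measurable (lborel \<Otimes>\<^sub>M lborel)" by measurable
    have "integrable lborel (\<lambda>t. cmod (F t) * (LINT v|lborel. cmod (h v)))"
      using F by simp
    then show "integrable lborel (\<lambda>t. LINT v|lborel. norm (case_prod ?K (t, v)))"
      by (simp add: norm_mult)
    have "integrable lborel (\<lambda>v. h v * cis (- (2 * pi * t * v)))" for t
      by (rule Bochner_Integration.integrable_bound[OF h]) (auto simp: norm_mult)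
    then show "AE t in lborel. integrable lborel (\<lambda>v. case_prod ?K (t, v))" by simp
  qed
  then have "(LINT v|lborel. LINT t|lborel. ?K t v) = (LINT t|lborel. LINT v|lborel. ?K t v)"
    by (rule lborel_pair.Fubini_integral)
  moreover have "(LINT t|lborel. ?K t v) = fourier_L1 F v * h v" for v
    unfolding fourier_L1_cis
    by (subst integral_mult_left_zero[symmetric]) (simp add: mult_ac)
  moreover have "(LINT v|lborel. ?K t v) = F t * fourier_L1 h t" for t
    unfolding fourier_L1_cis by (simp add: mult_ac)
  ultimately show ?thesis by (simp only:)
qed

text \<open>
  The relation \<open>has_fourier_L2\<close> speaks of approximating sequences only; this identity extracts from it
  everything that is used below.
\<close>
lemma has_fourier_L2_pairing:
  assumes "has_fourier_L2 f g" and h: "integrable lborel h" "in_L2 h" "in_L2 (fourier_L1 h)"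
  shows "(LINT v|lborel. g v * h v) = (LINT t|lborel. f t * fourier_L1 h t)"
proof -
  obtain F where F: "\<And>n. integrable lborel (F n)" "L2_tendsto F f" "L2_tendsto (\<lambda>n. fourier_L1 (F n)) g"
    using assms(1) by (auto simp: has_fourier_L2_def)
  have "(\<lambda>n. LINT v|lborel. fourier_L1 (F n) v * h v) \<longlonglongrightarrow> (LINT v|lborel. g v * h v)"
    by (rule L2_tendsto_pairing[OF F(3) h(2)])
  then have "(\<lambda>n. LINT t|lborel. F n t * fourier_L1 h t) \<longlonglongrightarrow> (LINT v|lborel. g v * h v)"
    by (simp add: fourier_L1_multiplication[OF F(1) h(1)])
  moreover have "(\<lambda>n. LINT t|lborel. F n t * fourier_L1 h t) \<longlonglongrightarrow> (LINT t|lborel. f t * fourier_L1 h t)"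
    by (rule L2_tendsto_pairing[OF F(2) h(3)])
  ultimately show ?thesis by (rule LIMSEQ_unique)
qed

text \<open>
  The complement of the support is a union of possibly uncountably many open sets on each of which \<open>g\<close>
  vanishes almost everywhere; Lindelof's theorem leaves countably many null sets.
\<close>
lemma AE_zero_outside_ess_support:
  assumes "ess_support g \<subseteq> {a..b}"
  shows "AE v in lborel. v \<notin> {a..b} \<longrightarrow> g v = 0"
proof -
  let ?F = "{U. open U \<and> (AE v in lborel. v \<in> U \<longrightarrow> g v = 0)}"
  obtain F' where F': "F' \<subseteq> ?F" "countable F'" "\<Union>F' = \<Union>?F"
    by (rule Lindelof[of ?F]) auto
  have "AE v in lborel. \<forall>U\<in>F'. v \<in> U \<longrightarrow> g v = 0"
    using F' by (subst AE_ball_countable) auto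
  moreover have "- {a..b} \<subseteq> \<Union>F'"
    using assms unfolding F'(3) ess_support_def by auto
  ultimately show ?thesis by (elim eventually_mono) auto
qed

text \<open>
  After the substitution \<open>w = 2 * pi * e * v\<close> this is the characteristic function of the standard normal
  distribution, evaluated at \<open>(t - x) / e\<close>.
\<close>
lemma fourier_L1_gaussian:
  assumes e: "e > 0"
  shows "fourier_L1 (\<lambda>v. cis (2 * pi * t * v) * of_real (exp (- (2 * pi * e * v)\<^sup>2 / 2))) x
       = of_real (normal_density t e x)"
proof -
  let ?\<tau> = "(t - x) / e"
  have "(LINT w|lborel. std_normal_density w *\<^sub>R cis (?\<tau> * w)) = of_real (exp (- (?\<tau>\<^sup>2) / 2))"
  proof -
    have "char std_normal_distribution ?\<tau> = (LINT w|lborel. std_normal_density w *\<^sub>R iexp (?\<tau> * w))"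
      unfolding char_def by (subst integral_density) (auto simp: normal_density_nonneg)
    then show ?thesis
      by (simp add: char_std_normal_distribution cis_conv_exp)
  qed
  also have "(LINT w|lborel. std_normal_density w *\<^sub>R cis (?\<tau> * w))
      = (2 * pi * e) *\<^sub>R (LINT v|lborel. std_normal_density (2 * pi * e * v) *\<^sub>R cis (?\<tau> * (2 * pi * e * v)))"
    using e by (subst lborel_integral_real_affine[where c = "2 * pi * e" and t = 0]) auto
  also have "(LINT v|lborel. std_normal_density (2 * pi * e * v) *\<^sub>R cis (?\<tau> * (2 * pi * e * v)))
      = (LINT v|lborel. of_real (1 / sqrt (2 * pi)) *
           (cis (2 * pi * t * v) * of_real (exp (- (2 * pi * e * v)\<^sup>2 / 2)) * cis (- (2 * pi * v * x))))"
  proof (intro Bochner_Integration.integral_cong refl)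
    fix v
    have "?\<tau> * (2 * pi * e * v) = 2 * pi * t * v + - (2 * pi * v * x)"
      using e by (simp add: field_simps)
    then have "cis (?\<tau> * (2 * pi * e * v)) = cis (2 * pi * t * v) * cis (- (2 * pi * v * x))"
      by (simp only: cis_mult)
    then show "std_normal_density (2 * pi * e * v) *\<^sub>R cis (?\<tau> * (2 * pi * e * v))
       = of_real (1 / sqrt (2 * pi)) *
           (cis (2 * pi * t * v) * of_real (exp (- (2 * pi * e * v)\<^sup>2 / 2)) * cis (- (2 * pi * v * x)))"
      by (simp add: std_normal_density_def scaleR_conv_of_real)
  qed
  also have "\<dots> = of_real (1 / sqrt (2 * pi)) *
       fourier_L1 (\<lambda>v. cis (2 * pi * t * v) * of_real (exp (- (2 * pi * e * v)\<^sup>2 / 2))) x"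
    unfolding fourier_L1_cis by simp
  finally have eq: "of_real (2 * pi * e * (1 / sqrt (2 * pi))) *
       fourier_L1 (\<lambda>v. cis (2 * pi * t * v) * of_real (exp (- (2 * pi * e * v)\<^sup>2 / 2))) x
       = complex_of_real (exp (- (?\<tau>\<^sup>2) / 2))"
    by (simp add: scaleR_conv_of_real mult_ac)
  have "2 * pi * e * (1 / sqrt (2 * pi)) = e * sqrt (2 * pi)"
    by (simp add: real_div_sqrt field_simps)
  moreover have "exp (- (?\<tau>\<^sup>2) / 2) = e * sqrt (2 * pi) * normal_density t e x"
    using e by (simp add: normal_density_def real_sqrt_mult power2_commute power_divide)
  moreover have "e * sqrt (2 * pi) \<noteq> 0" using e by simp
  ultimately show ?thesis
    using eq by (simp only: of_real_mult) (simp add: mult.assoc)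
qed

text \<open>
  Writing Gaussians as multiples of probability densities gives their integrability and total mass.
\<close>
lemma gaussian_eq_normal_density:
  assumes "s > 0"
  shows "exp (- (u - x)\<^sup>2 / (2 * s\<^sup>2)) = s * sqrt (2 * pi) * normal_density x s u"
  using assms by (simp add: normal_density_def real_sqrt_mult)

text \<open>
  The product \<open>u\<^sup>2 * exp (- u\<^sup>2 / 2)\<close> is bounded, so at a fixed distance from the mean the density is \<open>O(e)\<close>.
\<close>
lemma normal_density_le_of_far:
  assumes "e > 0" "\<eta> > 0" "\<eta> \<le> \<bar>x - t\<bar>"
  shows "normal_density t e x \<le> e / \<eta>\<^sup>2"
proof -
  define u where "u = (x - t) / e"
  have "2 < sqrt (2 * pi)" using pi_gt3 by (intro real_less_rsqrt) auto
  then have "2 * exp (u\<^sup>2 / 2) \<le> sqrt (2 * pi) * exp (u\<^sup>2 / 2)"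
    by (intro mult_right_mono) auto
  moreover have "u\<^sup>2 / 2 \<le> exp (u\<^sup>2 / 2)"
    using exp_ge_add_one_self[of "u\<^sup>2 / 2"] by linarith
  ultimately have "u\<^sup>2 \<le> sqrt (2 * pi) * exp (u\<^sup>2 / 2)" by linarith
  then have "u\<^sup>2 * std_normal_density u \<le> 1"
    by (simp add: std_normal_density_def exp_minus field_simps)
  moreover have nd: "normal_density t e x = std_normal_density u / e"
    using assms by (simp add: normal_density_def u_def real_sqrt_mult power_divide)
  moreover have xt: "(x - t)\<^sup>2 = e\<^sup>2 * u\<^sup>2" using assms by (simp add: u_def power_divide)
  moreover from xt have "(x - t)\<^sup>2 * normal_density t e x = e * (u\<^sup>2 * std_normal_density u)"
    using assms nd by (simp add: power2_eq_square)
  ultimately have "(x - t)\<^sup>2 * normal_density t e x \<le> e"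
    using assms by simp
  moreover have "\<eta>\<^sup>2 \<le> (x - t)\<^sup>2"
    using assms by (intro abs_le_square_iff[THEN iffD1]) auto
  ultimately have "\<eta>\<^sup>2 * normal_density t e x \<le> e"
    by (meson mult_right_mono normal_density_nonneg order_trans)
  then show ?thesis using assms by (simp add: field_simps)
qed

lemma in_L2_normal_density: "e > 0 \<Longrightarrow> in_L2 (\<lambda>x. of_real (normal_density t e x))"
proof (rule in_L2_bounded_integrable)
  assume e: "e > 0"
  show "integrable lborel (\<lambda>x. complex_of_real (normal_density t e x))" using e by simp
  fix x
  have "normal_density t e x \<le> 1 / sqrt (2 * pi * e\<^sup>2) * 1"
    unfolding normal_density_def by (intro mult_left_mono) auto
  then show "cmod (of_real (normal_density t e x)) \<le> 1 / sqrt (2 * pi * e\<^sup>2)" by simp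
qed

text \<open>
  Near \<open>t\<close> continuity suffices.  Away from \<open>t\<close> the function may be unbounded, and only its square is known
  to be integrable.  There one factor \<open>sqrt \<rho>\<close> of the density \<open>\<rho>\<close> is uniformly small, and the other is absorbed
  by \<open>\<bar>f\<bar> * sqrt \<rho> \<le> \<bar>f\<bar>\<^sup>2 + \<rho>\<close>.
\<close>
lemma gaussian_approximate_identity:
  assumes f: "in_L2 f" and cont: "isCont f t"
  shows "((\<lambda>e. LINT x|lborel. f x * of_real (normal_density t e x)) \<longlongrightarrow> f t) (at_right 0)"
proof (rule tendstoI)
  fix r :: real assume r: "r > 0"
  obtain \<eta> where \<eta>: "\<eta> > 0" "\<And>x. \<bar>x - t\<bar> < \<eta> \<Longrightarrow> cmod (f x - f t) \<le> r / 2"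
    using cont r unfolding continuous_at_eps_delta dist_norm
    by (metis half_gt_zero less_eq_real_def real_norm_def)
  let ?Q = "(L2_norm f)\<^sup>2"
  define err where "err = (\<lambda>e. sqrt (e / \<eta>\<^sup>2) * (?Q + 1) + cmod (f t) * (e\<^sup>2 / \<eta>\<^sup>2))"
  have "(err \<longlongrightarrow> sqrt (0 / \<eta>\<^sup>2) * (?Q + 1) + cmod (f t) * (0\<^sup>2 / \<eta>\<^sup>2)) (at_right 0)"
    unfolding err_def using \<eta> by (intro tendsto_intros) auto
  then have "\<forall>\<^sub>F e in at_right 0. err e < r / 2"
    using r by (intro order_tendstoD(2)) auto
  moreover have "\<forall>\<^sub>F e in at_right 0. (0::real) < e"
    by (rule eventually_at_right_less)
  ultimately show "\<forall>\<^sub>F e in at_right 0. dist (LINT x|lborel. f x * of_real (normal_density t e x)) (f t) < r"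
  proof eventually_elim
    case (elim e)
    let ?\<rho> = "normal_density t e"
    let ?M = "sqrt (e / \<eta>\<^sup>2)"
    let ?b = "\<lambda>x. r / 2 * ?\<rho> x + ?M * ((cmod (f x))\<^sup>2 + ?\<rho> x) + cmod (f t) * (?\<rho> x * (x - t)\<^sup>2 / \<eta>\<^sup>2)"
    have i1: "integrable lborel (\<lambda>x. f x * of_real (?\<rho> x))"
      using integrable_mult_in_L2[OF f in_L2_normal_density] elim by simp
    have i2: "integrable lborel (\<lambda>x. f t * of_real (?\<rho> x))" using elim by simp
    \<comment> \<open>The variance bounds the mass of the density beyond distance \<open>\<eta>\<close>, as in Chebyshev's inequality.\<close>
    have mom: "has_bochner_integral lborel (\<lambda>x. ?\<rho> x * (x - t)\<^sup>2) (e\<^sup>2)"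
      using normal_moment_even[where k = 1 and \<mu> = t and \<sigma> = e] elim by (simp add: power2_eq_square)
    have ib: "integrable lborel ?b" using elim mom in_L2D[OF f]
      by (intro Bochner_Integration.integrable_add integrable_mult_right Bochner_Integration.integrable_divide)
        (auto simp: has_bochner_integral_iff)
    have pt: "cmod (f x * of_real (?\<rho> x) - f t * of_real (?\<rho> x)) \<le> ?b x" for x
    proof -
      have \<rho>: "0 \<le> ?\<rho> x" by simp
      have eq: "cmod (f x * of_real (?\<rho> x) - f t * of_real (?\<rho> x)) = cmod (f x - f t) * ?\<rho> x"
        by (simp add: norm_mult flip: left_diff_distrib)
      show ?thesis
      proof (cases "\<bar>x - t\<bar> < \<eta>")
        case True
        then have "cmod (f x - f t) * ?\<rho> x \<le> r / 2 * ?\<rho> x"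
          using \<eta>(2) by (intro mult_right_mono) auto
        moreover have "0 \<le> ?M * ((cmod (f x))\<^sup>2 + ?\<rho> x)" "0 \<le> cmod (f t) * (?\<rho> x * (x - t)\<^sup>2 / \<eta>\<^sup>2)"
          using elim by (auto intro!: mult_nonneg_nonneg)
        ultimately show ?thesis unfolding eq by linarith
      next
        case False
        have "?\<rho> x \<le> e / \<eta>\<^sup>2"
          using normal_density_le_of_far[of e \<eta> x t] False elim \<eta> by simp
        then have "sqrt (?\<rho> x) \<le> ?M" by simp
        moreover have "cmod (f x) * sqrt (?\<rho> x) \<le> (cmod (f x))\<^sup>2 + ?\<rho> x"
        proof -
          have "2 * (cmod (f x) * sqrt (?\<rho> x)) \<le> (cmod (f x))\<^sup>2 + (sqrt (?\<rho> x))\<^sup>2"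
            using sum_squares_bound[of "cmod (f x)" "sqrt (?\<rho> x)"] by simp
          moreover have "0 \<le> cmod (f x) * sqrt (?\<rho> x)" "(sqrt (?\<rho> x))\<^sup>2 = ?\<rho> x" by simp_all
          ultimately show ?thesis by linarith
        qed
        ultimately have "sqrt (?\<rho> x) * (cmod (f x) * sqrt (?\<rho> x)) \<le> ?M * ((cmod (f x))\<^sup>2 + ?\<rho> x)"
          using elim by (intro mult_mono) auto
        moreover have "sqrt (?\<rho> x) * (cmod (f x) * sqrt (?\<rho> x)) = cmod (f x) * ?\<rho> x"
          using \<rho> by (metis mult.left_commute real_sqrt_mult_self abs_of_nonneg)
        moreover have "cmod (f t) * ?\<rho> x \<le> cmod (f t) * (?\<rho> x * (x - t)\<^sup>2 / \<eta>\<^sup>2)"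
        proof -
          have "\<eta>\<^sup>2 \<le> (x - t)\<^sup>2"
            using False \<eta> by (intro abs_le_square_iff[THEN iffD1]) auto
          then have "?\<rho> x * 1 \<le> ?\<rho> x * ((x - t)\<^sup>2 / \<eta>\<^sup>2)"
            using \<eta> by (intro mult_left_mono) auto
          then show ?thesis by (intro mult_left_mono) auto
        qed
        moreover have "cmod (f x - f t) * ?\<rho> x \<le> cmod (f x) * ?\<rho> x + cmod (f t) * ?\<rho> x"
          using mult_right_mono[OF norm_triangle_ineq4[of "f x" "f t"] \<rho>] by (simp add: distrib_right)
        moreover have "0 \<le> r / 2 * ?\<rho> x" using r by simp
        ultimately show ?thesis unfolding eq by linarith
      qed
    qed
    have "dist (LINT x|lborel. f x * of_real (?\<rho> x)) (f t)
       = cmod (LINT x|lborel. f x * of_real (?\<rho> x) - f t * of_real (?\<rho> x))"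
      using i1 i2 elim by (simp add: dist_norm)
    also have "\<dots> \<le> (LINT x|lborel. ?b x)"
      using pt by (intro order_trans[OF integral_norm_bound integral_mono] integrable_norm
          Bochner_Integration.integrable_diff i1 i2 ib) auto
    also have "\<dots> = r / 2 + err e"
      using elim mom in_L2D[OF f] ib by (simp add: err_def has_bochner_integral_iff L2_norm_power2)
    also have "\<dots> < r" using elim by simp
    finally show ?case .
  qed
qed

text \<open>
  Since \<open>g\<close> has compact support it is integrable, and the pairing identity can be used with two test functions.
  A modulated Gaussian of growing width recovers the value of the continuous function \<open>f\<close> at a point.  Once the
  inversion formula is known, the transform of the conjugate of \<open>g\<close> is the conjugate of \<open>f\<close>, and pairing with it
  gives the equality of norms.
\<close>
lemma Paley_Wiener_inversion:
  assumes f: "in_L2 f" "\<And>t. isCont f t" and fg: "has_fourier_L2 f g0" "ess_support g0 \<subseteq> {- \<delta>..\<delta>}"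
  obtains g where "in_L2 g" "integrable lborel g" "\<And>v. v \<notin> {- \<delta>..\<delta>} \<Longrightarrow> g v = 0"
    "\<And>t. f t = (LINT v|lborel. g v * cis (2 * pi * t * v))" "L2_norm g = L2_norm f"
proof -
  have g0: "in_L2 g0" using fg(1) by (auto simp: has_fourier_L2_def L2_tendsto_def)
  define g where "g = (\<lambda>v. indicator {- \<delta>..\<delta>} v * g0 v)"
  have [measurable]: "g0 \<in> borel_measurable borel" using g0 by (rule in_L2D)
  \<comment> \<open>Replacing \<open>g0\<close> by \<open>g\<close> changes it on a null set only and makes it vanish everywhere outside the band.\<close>
  have ae: "AE v in lborel. g0 v = g v"
    using AE_zero_outside_ess_support[OF fg(2)] by eventually_elim (auto simp: g_def indicator_def)
  have gL2: "in_L2 g" unfolding in_L2_def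
  proof
    show "g \<in> borel_measurable borel" unfolding g_def by measurable
    then show "integrable lborel (\<lambda>v. (cmod (g v))\<^sup>2)"
      by (intro Bochner_Integration.integrable_bound[OF in_L2D(2)[OF g0]])
        (auto simp: g_def indicator_def)
  qed
  then have [measurable]: "g \<in> borel_measurable borel" by (rule in_L2D)
  have gint: "integrable lborel g"
  proof -
    have fin: "integrable lborel (indicator {- \<delta>..\<delta>} :: real \<Rightarrow> complex)"
    proof -
      have "(indicator {- \<delta>..\<delta>} :: real \<Rightarrow> complex) = (\<lambda>v. of_real (indicator {- \<delta>..\<delta>} v))"
        by (auto simp: indicator_def)
      then show ?thesis
        by (simp only:) (intro integrable_of_real integrable_real_indicator; cases "- \<delta> \<le> \<delta>"; simp)
    qed
    have "in_L2 (indicator {- \<delta>..\<delta>})"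
      by (rule in_L2_bounded_integrable[OF fin, of 1]) (auto simp: indicator_def)
    from integrable_mult_in_L2[OF this g0] show ?thesis by (simp add: g_def)
  qed
  have pair: "(LINT v|lborel. g v * h v) = (LINT t|lborel. f t * fourier_L1 h t)"
    if h: "integrable lborel h" "in_L2 h" "in_L2 (fourier_L1 h)" for h
  proof -
    have [measurable]: "h \<in> borel_measurable borel" using h(2) by (rule in_L2D)
    have "(LINT v|lborel. g v * h v) = (LINT v|lborel. g0 v * h v)"
      using ae by (intro integral_cong_AE) auto
    then show ?thesis using has_fourier_L2_pairing[OF fg(1) h] by simp
  qed
  have inv: "f t = (LINT v|lborel. g v * cis (2 * pi * t * v))" for t
  proof -
    let ?\<gamma> = "\<lambda>e v. cis (2 * pi * t * v) * complex_of_real (exp (- (2 * pi * e * v)\<^sup>2 / 2))"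
    have eq: "(LINT v|lborel. g v * ?\<gamma> e v) = (LINT x|lborel. f x * of_real (normal_density t e x))"
      if e: "e > 0" for e
    proof -
      define w where "w = 1 / (2 * pi * e)"
      have w: "w > 0" using e by (simp add: w_def)
      have G: "exp (- (2 * pi * e * v)\<^sup>2 / 2) = w * sqrt (2 * pi) * normal_density 0 w v" for v
        using e unfolding gaussian_eq_normal_density[OF w, symmetric]
        by (simp add: w_def power_divide power_mult_distrib)
      have "integrable lborel (\<lambda>v. complex_of_real (exp (- (2 * pi * e * v)\<^sup>2 / 2)))"
        unfolding G using w by simp
      then have i: "integrable lborel (?\<gamma> e)"
        by (rule Bochner_Integration.integrable_bound) (auto simp: norm_mult)
      then have "in_L2 (?\<gamma> e)"
        by (rule in_L2_bounded_integrable[of _ 1]) (auto simp: norm_mult)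
      moreover have "fourier_L1 (?\<gamma> e) = (\<lambda>x. of_real (normal_density t e x))"
        by (rule ext) (rule fourier_L1_gaussian[OF e])
      ultimately show ?thesis using pair[OF i] in_L2_normal_density[OF e] by simp
    qed
    have seq: "filterlim (\<lambda>n. 1 / real (Suc n)) (at_right 0) sequentially"
      by real_asymp
    have "(\<lambda>n. LINT v|lborel. g v * ?\<gamma> (1 / real (Suc n)) v) \<longlonglongrightarrow> (LINT v|lborel. g v * cis (2 * pi * t * v))"
    proof (rule integral_dominated_convergence[where w = "\<lambda>v. cmod (g v)"])
      show "AE v in lborel. (\<lambda>n. g v * ?\<gamma> (1 / real (Suc n)) v) \<longlonglongrightarrow> g v * cis (2 * pi * t * v)"
      proof (rule AE_I2)
        fix v
        have "(\<lambda>n. ?\<gamma> (1 / real (Suc n)) v) \<longlonglongrightarrow> cis (2 * pi * t * v) * complex_of_real (exp (- (2 * pi * 0 * v)\<^sup>2 / 2))"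
          by (intro tendsto_intros LIMSEQ_Suc lim_1_over_n) auto
        then show "(\<lambda>n. g v * ?\<gamma> (1 / real (Suc n)) v) \<longlonglongrightarrow> g v * cis (2 * pi * t * v)"
          by (intro tendsto_mult) auto
      qed
      show "AE v in lborel. cmod (g v * ?\<gamma> (1 / real (Suc n)) v) \<le> cmod (g v)" for n
        by (auto simp: norm_mult intro!: AE_I2 mult_left_le)
    qed (use gint in auto)
    moreover have "(\<lambda>n. LINT v|lborel. g v * ?\<gamma> (1 / real (Suc n)) v) \<longlonglongrightarrow> f t"
      using filterlim_compose[OF gaussian_approximate_identity[OF f(1) f(2)] seq]
      by (simp only: eq zero_less_divide_1_iff of_nat_0_less_iff zero_less_Suc)
    ultimately show ?thesis by (rule LIMSEQ_unique[symmetric])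
  qed
  have "L2_norm g = L2_norm f"
  proof -
    let ?h = "\<lambda>v. cnj (g v)"
    \<comment> \<open>Conjugation turns the inversion formula into a Fourier integral.\<close>
    have F: "fourier_L1 ?h = (\<lambda>t. cnj (f t))"
    proof
      fix t
      have "cnj (f t) = (LINT v|lborel. cnj (g v * cis (2 * pi * t * v)))"
        unfolding inv by (rule Bochner_Integration.integral_cnj[symmetric])
      then show "fourier_L1 ?h t = cnj (f t)"
        unfolding fourier_L1_cis by (simp add: cis_cnj mult_ac)
    qed
    have L2cnj: "in_L2 (\<lambda>t. cnj (u t))" if "in_L2 u" for u
    proof -
      have [measurable]: "cnj \<in> borel_measurable borel"
        by (intro borel_measurable_continuous_onI continuous_intros)
      show ?thesis using that by (auto simp: in_L2_def)
    qed
    have "(LINT v|lborel. g v * cnj (g v)) = (LINT t|lborel. f t * cnj (f t))"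
      using pair[of ?h] gint L2cnj gL2 f(1) unfolding F by simp
    moreover have "(LINT v|lborel. u v * cnj (u v)) = of_real ((L2_norm u)\<^sup>2)" for u
      by (simp only: complex_norm_square[symmetric] L2_norm_power2 integral_complex_of_real)
    ultimately have "(L2_norm g)\<^sup>2 = (L2_norm f)\<^sup>2" by (simp only: of_real_eq_iff)
    then show ?thesis by (simp add: L2_norm_nonneg power2_eq_iff_nonneg)
  qed
  then show ?thesis
    using that[of g] gL2 gint inv by (auto simp: g_def)
qed

section \<open>Sinc interpolation with a Gaussian factor, by residues\<close>

lemma contour_integral_linepath_same_Im:
  assumes "a < b"
  shows "contour_integral (linepath (Complex a c) (Complex b c)) h
         = integral {a..b} (\<lambda>u. h (Complex u c))"
proof -
  have "contour_integral (linepath (Complex a c) (Complex b c)) h =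
         (Complex b c - Complex a c) * integral {0..1} (\<lambda>t. h (linepath (Complex a c) (Complex b c) t))"
    by (simp add: contour_integral_integral)
  also have "Complex b c - Complex a c = of_real (b - a)"
    by (simp add: complex_eq_iff)
  also have "integral {0..1} (\<lambda>t. h (linepath (Complex a c) (Complex b c) t)) =
             integral {0..1} (\<lambda>t. h (Complex (linepath a b t) c))"
    by (simp add: linepath_def Complex_eq scaleR_conv_of_real algebra_simps)
  also have "\<dots> = integral {0..(b - a) / (b - a)} (\<lambda>t. h (Complex (a + (b - a) * t) c))"
    using \<open>a < b\<close> by (simp add: algebra_simps linepath_def)
  also have "{0..(b - a) / (b - a)} = (\<lambda>x. x / (b - a)) ` {0..b - a}"
    using \<open>a < b\<close> by simp
  also have "integral \<dots> (\<lambda>t. h (Complex (a + (b - a) * t) c)) =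
             integral {a-a..b-a} (\<lambda>t. h (Complex (t + a) c)) / of_real (b - a)"
    using \<open>a < b\<close> by (subst integral_stretch_real) (auto simp: scaleR_conv_of_real add_ac)
  also have "\<dots> = integral {a..b} (\<lambda>t. h (Complex t c)) / of_real (b - a)"
    by (subst integral_shift_real_ivl) (rule refl)
  finally show ?thesis
    using \<open>a < b\<close> by simp
qed

text \<open>
  Dominating the integrand by a Gaussian makes the bound independent of the length of the segment.
\<close>
lemma contour_integral_gaussian_bound:
  fixes a b c x s C :: real
  assumes ab: "a < b" and s: "s > 0" and C: "0 \<le> C"
    and cont: "continuous_on (closed_segment (Complex a c) (Complex b c)) h"
    and bound: "\<And>u. u \<in> {a..b} \<Longrightarrow> cmod (h (Complex u c)) \<le> C * exp (- (u - x)\<^sup>2 / (2 * s\<^sup>2))"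
  shows "cmod (contour_integral (linepath (Complex a c) (Complex b c)) h) \<le> C * (s * sqrt (2 * pi))"
proof -
  let ?g = "\<lambda>u. C * exp (- (u - x)\<^sup>2 / (2 * s\<^sup>2))"
  let ?K = "C * (s * sqrt (2 * pi))"
  have g: "?g = (\<lambda>u. ?K * normal_density x s u)"
    by (rule ext) (simp only: gaussian_eq_normal_density[OF s] mult.assoc)
  have int: "integrable lborel ?g" using s unfolding g by simp
  have "continuous_on {a..b} (\<lambda>u. Complex u c)"
    by (auto simp: Complex_eq intro!: continuous_intros)
  moreover have "(\<lambda>u. Complex u c) ` {a..b} \<subseteq> closed_segment (Complex a c) (Complex b c)"
    using ab by (auto simp: closed_segment_same_Im closed_segment_eq_real_ivl)
  ultimately have "continuous_on {a..b} (\<lambda>u. h (Complex u c))"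
    using continuous_on_compose2[OF cont] by blast
  moreover have gint: "?g integrable_on {a..b}"
    using s by (intro integrable_continuous_interval continuous_intros) auto
  ultimately have "cmod (integral {a..b} (\<lambda>u. h (Complex u c))) \<le> integral {a..b} ?g"
    by (intro integral_norm_bound_integral[OF integrable_continuous_interval gint bound])
  also have "\<dots> \<le> integral UNIV ?g"
    using C by (intro integral_subset_le[OF subset_UNIV gint integrable_on_lborel[OF int]]) auto
  also have "\<dots> = ?K"
    unfolding integral_lborel[OF int] unfolding g using s by simp
  finally show ?thesis by (simp add: contour_integral_linepath_same_Im[OF ab])
qed

text \<open>
  The denominator on the horizontal sides of the contour.
\<close>
lemma cmod_sin_ge_sinh: "\<bar>sinh (Im z)\<bar> \<le> cmod (sin z)"
proof -
  have "\<bar>cmod (exp (\<i> * z)) - cmod (exp (- (\<i> * z)))\<bar> \<le> cmod (exp (\<i> * z) - exp (- (\<i> * z)))"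
    by (rule norm_triangle_ineq3)
  moreover have "cmod (sin z) = cmod (exp (\<i> * z) - exp (- (\<i> * z))) / 2"
    by (simp add: sin_exp_eq norm_divide norm_mult)
  ultimately show ?thesis by (simp add: sinh_def abs_minus_commute)
qed

text \<open>
  The denominator on the vertical sides of the contour, which pass halfway between two poles.
\<close>
lemma cmod_sin_half_integer_ge:
  assumes "Re z = pi * (of_int k + 1 / 2)"
  shows "1 \<le> cmod (sin z)"
proof -
  have "cos (of_int k * pi) = (- 1 :: real) ^ nat \<bar>k\<bar>"
    by (cases "k \<ge> 0") (use cos_npi[of "nat k"] cos_npi[of "nat (-k)"] in \<open>auto simp: abs_if\<close>)
  then have "\<bar>sin (Re z)\<bar> = 1"
    using assms by (simp add: sin_add algebra_simps)
  moreover have "1 \<le> (exp (Im z) + exp (- Im z)) / 2"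
    using cosh_real_ge_1[of "Im z"] by (simp add: cosh_def)
  ultimately have "1 \<le> \<bar>Re (sin z)\<bar>"
    by (simp add: Re_sin abs_mult flip: times_divide_eq_right)
  then show ?thesis using abs_Re_le_cmod[of "sin z"] by linarith
qed

text \<open>
  Near an integer, \<open>sin (pi * z)\<close> has a simple zero with derivative \<open>pi * cos (pi * l)\<close>.
\<close>
lemma residue_div_sin_at_int:
  fixes E :: "complex \<Rightarrow> complex" and x :: real and l :: int
  assumes E: "E holomorphic_on UNIV" and x: "x \<notin> \<int>"
  shows "residue (\<lambda>z. E z / ((z - of_real x) * sin (of_real pi * z))) (of_int l)
       = E (of_int l) / ((of_int l - of_real x) * (of_real pi * cos (of_real pi * of_int l)))"
proof (rule residue_simple')
  let ?l = "of_int l :: complex"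
  have sl: "sin (of_real pi * ?l) = 0"
    by (metis mult.commute sin_eq_0 of_real_mult of_real_of_int_eq)
  have lx: "?l \<noteq> of_real x"
    using x by (metis Ints_of_int of_real_eq_iff of_real_of_int_eq)
  let ?D = "of_real pi * cos (of_real pi * ?l)"
  have "cos (of_real pi * ?l) \<noteq> 0"
    using sl sin_cos_squared_add[of "of_real pi * ?l"] by auto
  then have D: "?D \<noteq> 0" by simp
  have "((\<lambda>w. sin (of_real pi * w)) has_field_derivative ?D) (at ?l)"
    by (auto intro!: derivative_eq_intros)
  then have "((\<lambda>w. sin (of_real pi * w) / (w - ?l)) \<longlongrightarrow> ?D) (at ?l)"
    by (simp add: has_field_derivative_iff sl)
  moreover have "isCont E ?l"
    using E by (meson UNIV_I holomorphic_on_imp_continuous_on continuous_on_eq_continuous_at open_UNIV)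
  ultimately have "((\<lambda>w. E w / (w - of_real x) / (sin (of_real pi * w) / (w - ?l)))
      \<longlongrightarrow> E ?l / (?l - of_real x) / ?D) (at ?l)"
    using lx D unfolding isCont_def by (intro tendsto_intros) auto
  then show "((\<lambda>w. E w / ((w - of_real x) * sin (of_real pi * w)) * (w - ?l))
      \<longlongrightarrow> E ?l / ((?l - of_real x) * ?D)) (at ?l)"
    by (simp add: divide_simps)
  let ?S = "ball ?l 1 - {of_real x}"
  show "open ?S" by (simp add: open_delete)
  show "?l \<in> ?S" using lx by simp
  have "sin (of_real pi * w) \<noteq> 0" if "w \<in> ?S - {?l}" for w
  proof
    assume "sin (of_real pi * w) = 0"
    then obtain k :: int where "of_real pi * w = of_real (of_int k * pi)"
      using sin_eq_0 by auto
    then have w: "w = of_int k" by simp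
    moreover have "dist ?l w < 1" using that by auto
    ultimately have "\<bar>of_int l - of_int k :: real\<bar> < 1"
      by (simp add: dist_norm flip: of_int_diff)
    then have "l = k" by linarith
    then show False using that w by auto
  qed
  then show "(\<lambda>w. E w / ((w - of_real x) * sin (of_real pi * w))) holomorphic_on ?S - {?l}"
    by (intro holomorphic_intros holomorphic_on_subset[OF E]) auto
qed

lemma residue_div_sin_at_noninteger:
  fixes E :: "complex \<Rightarrow> complex" and x :: real
  assumes E: "E holomorphic_on UNIV" and x: "x \<notin> \<int>"
  shows "residue (\<lambda>z. E z / ((z - of_real x) * sin (of_real pi * z))) (of_real x)
       = E (of_real x) / sin (of_real pi * of_real x)"
proof -
  let ?S = "{z. sin (of_real pi * z) \<noteq> (0::complex)}"
  have "open ?S" by (intro open_Collect_neq continuous_intros)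
  moreover have "of_real x \<in> ?S"
  proof -
    have "sin (pi * x) \<noteq> 0"
      using x by (auto simp: sin_zero_iff_int2 mult.commute)
    then have "complex_of_real (sin (pi * x)) \<noteq> 0" by simp
    then show ?thesis by (simp only: mem_Collect_eq sin_of_real flip: of_real_mult)  simp
  qed
  ultimately have "residue (\<lambda>z. E z / sin (of_real pi * z) / (z - of_real x)) (of_real x)
     = E (of_real x) / sin (of_real pi * of_real x)"
    by (intro residue_simple[of ?S]) (auto intro!: holomorphic_intros holomorphic_on_subset[OF E])
  then show ?thesis by (simp add: mult.commute)
qed

text \<open>
  The poles inside the rectangle are \<open>x\<close>, whose residue is \<open>E x / sin (pi * x)\<close>, and the integers from \<open>- n\<close> to
  \<open>n\<close>.  As \<open>sin (pi * (x - l)) = sin (pi * x) * cos (pi * l)\<close>, the factor \<open>sin (pi * x)\<close> turns the residue at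
  \<open>l\<close> into minus the term of the sinc series.
\<close>
lemma sinc_interpolation_remainder:
  fixes E :: "complex \<Rightarrow> complex" and x Y :: real and n :: nat
  assumes E: "E holomorphic_on UNIV" and x: "x \<notin> \<int>" "\<bar>x\<bar> < real n + 1 / 2" and Y: "Y > 0"
  shows "E (of_real x) - (\<Sum>l\<in>{- int n..int n}. of_real (sinc (pi * (x - of_int l))) * E (of_int l))
       = of_real (sin (pi * x)) / (2 * of_real pi * \<i>) *
         contour_integral (rectpath (Complex (- (real n + 1 / 2)) (- Y)) (Complex (real n + 1 / 2) Y))
           (\<lambda>z. E z / ((z - of_real x) * sin (of_real pi * z)))"
proof -
  define W where "W = (\<lambda>z. E z / ((z - of_real x) * sin (of_real pi * z)))"
  define R where "R = real n + 1 / 2"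
  define \<gamma> where "\<gamma> = rectpath (Complex (- R) (- Y)) (Complex R Y)"
  define S where "S = {z. - (real n + 1) < Re z} \<inter> {z. Re z < real n + 1}"
  define I where "I = {- int n..int n}"
  define pts where "pts = insert (complex_of_real x) (of_int ` I)"
  have inbox: "p \<in> box (Complex (- R) (- Y)) (Complex R Y)" if "p \<in> pts" for p
  proof -
    have "\<bar>real_of_int l\<bar> \<le> real n" if "l \<in> I" for l
      using that unfolding I_def by auto
    then show ?thesis
      using that x Y unfolding pts_def R_def by (fastforce simp: in_box_complex_iff abs_less_iff)
  qed
  have RY: "- R \<le> R" "- Y \<le> Y" using Y by (auto simp: R_def)
  have xI: "of_real x \<notin> (of_int ` I :: complex set)"
    using x(1) by (metis Ints_of_int image_iff of_real_eq_iff of_real_of_int_eq)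
  have "contour_integral \<gamma> W = 2 * pi * \<i> * (\<Sum>p\<in>pts. winding_number \<gamma> p * residue W p)"
  proof (rule Residue_theorem)
    show "open S" unfolding S_def by (intro open_Int open_halfspace_Re_lt open_halfspace_Re_gt)
    show "connected S" unfolding S_def
      by (intro convex_connected convex_Int convex_halfspace_Re_lt convex_halfspace_Re_gt)
    show "finite pts" by (simp add: pts_def I_def)
    show "W holomorphic_on S - pts"
    proof -
      have "(z - of_real x) * sin (of_real pi * z) \<noteq> 0" if z: "z \<in> S - pts" for z
      proof
        assume "(z - of_real x) * sin (of_real pi * z) = 0"
        moreover have "z \<noteq> of_real x" using z by (auto simp: pts_def)
        ultimately have "sin (of_real pi * z) = 0" by simp
        then obtain k :: int where "of_real pi * z = of_real (of_int k * pi)"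
          using sin_eq_0 by auto
        then have k: "z = of_int k" by simp
        then have "- (real n + 1) < of_int k" "of_int k < real n + 1"
          using z by (auto simp: S_def)
        then have "k \<in> I" unfolding I_def by auto
        then show False using z k by (auto simp: pts_def)
      qed
      then show ?thesis unfolding W_def
        by (intro holomorphic_intros holomorphic_on_subset[OF E]) auto
    qed
    show "valid_path \<gamma>" "pathfinish \<gamma> = pathstart \<gamma>" by (simp_all add: \<gamma>_def)
    show "path_image \<gamma> \<subseteq> S - pts"
    proof -
      have "path_image \<gamma> \<subseteq> S"
        using path_image_rectpath_subset_cbox[of "Complex (- R) (- Y)" "Complex R Y"] RY
        unfolding \<gamma>_def by (auto simp: in_cbox_complex_iff R_def S_def)
      moreover have "path_image \<gamma> \<inter> pts = {}"
        using path_image_rectpath_inter_box[of "Complex (- R) (- Y)" "Complex R Y"] RY inbox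
        unfolding \<gamma>_def by fastforce
      ultimately show ?thesis by blast
    qed
    show "\<forall>z. z \<notin> S \<longrightarrow> winding_number \<gamma> z = 0"
      unfolding \<gamma>_def using RY
      by (intro allI impI winding_number_rectpath_outside) (auto simp: S_def in_cbox_complex_iff R_def)
  qed
  also have "(\<Sum>p\<in>pts. winding_number \<gamma> p * residue W p) = (\<Sum>p\<in>pts. residue W p)"
    using inbox by (intro sum.cong refl) (simp add: \<gamma>_def winding_number_rectpath)
  also have "\<dots> = residue W (of_real x) + (\<Sum>l\<in>I. residue W (of_int l))"
    using xI unfolding pts_def
    by (subst sum.insert) (auto simp: I_def sum.reindex inj_on_def)
  finally have c: "contour_integral \<gamma> W
     = 2 * pi * \<i> * (residue W (of_real x) + (\<Sum>l\<in>I. residue W (of_int l)))" .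
  have sx: "sin (pi * x) \<noteq> 0"
    using x by (auto simp: sin_zero_iff_int2 mult.commute)
  have rx: "of_real (sin (pi * x)) * residue W (of_real x) = E (of_real x)"
  proof -
    have "sin (of_real pi * of_real x) = complex_of_real (sin (pi * x))"
      by (simp only: sin_of_real flip: of_real_mult)
    then show ?thesis
      using sx unfolding W_def residue_div_sin_at_noninteger[OF E x(1)] by simp
  qed
  have rl: "of_real (sin (pi * x)) * residue W (of_int l)
      = - (of_real (sinc (pi * (x - of_int l))) * E (of_int l))" for l
  proof -
    have s: "sin (pi * of_int l) = 0" by (auto simp: sin_zero_iff_int2 mult.commute)
    have cc: "cos (pi * of_int l) * cos (pi * of_int l) = 1"
      using sin_cos_squared_add[of "pi * of_int l"] s by (simp add: power2_eq_square)
    then have c: "cos (pi * of_int l) \<noteq> 0" by auto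
    from cc have "1 / cos (pi * of_int l) = cos (pi * of_int l)" using c by (simp add: field_simps)
    moreover have xl: "x - of_int l \<noteq> 0" using x(1) by auto
    moreover have "sin (pi * (x - of_int l)) = sin (pi * x) * cos (pi * of_int l)"
      using s by (simp add: right_diff_distrib sin_diff)
    ultimately have "sinc (pi * (x - of_int l))
        = - (sin (pi * x) * (1 / ((of_int l - x) * (pi * cos (pi * of_int l)))))"
      using c by (simp add: field_simps)
    then have A: "complex_of_real (sinc (pi * (x - of_int l)))
       = - (of_real (sin (pi * x)) * (1 / ((of_int l - of_real x) * (of_real pi * of_real (cos (pi * of_int l))))))"
      by (simp only: of_real_minus of_real_mult of_real_divide of_real_diff of_real_1 of_real_of_int_eq)
    have cl: "cos (of_real pi * of_int l) = complex_of_real (cos (pi * of_int l))"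
      using cos_of_real[of "pi * of_int l", where 'a = complex] by simp
    have "a * (e / d) = - (- (a * (1 / d)) * e)" for a e d :: complex by simp
    then show ?thesis
      unfolding W_def residue_div_sin_at_int[OF E x(1)] cl A .
  qed
  have "of_real (sin (pi * x)) / (2 * of_real pi * \<i>) * contour_integral \<gamma> W
     = of_real (sin (pi * x)) * (residue W (of_real x) + (\<Sum>l\<in>I. residue W (of_int l)))"
  proof -
    have "a / q * (q * X) = a * X" if "q \<noteq> 0" for a q X :: complex using that by simp
    from this[of "2 * of_real pi * \<i>"] show ?thesis unfolding c by simp
  qed
  also have "\<dots> = E (of_real x) - (\<Sum>l\<in>I. of_real (sinc (pi * (x - of_int l))) * E (of_int l))"
    by (simp add: distrib_left sum_distrib_left rx rl sum_negf)
  finally show ?thesis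
    unfolding W_def \<gamma>_def R_def I_def by simp
qed

text \<open>
  The residue formula is applied to the exponential times a Gaussian centred at \<open>x\<close>, which equals
  the exponential at \<open>x\<close> itself.  At height \<open>\<plusminus> Y\<close> the Gaussian grows by \<open>exp (Y\<^sup>2 / (2 * s\<^sup>2))\<close>, the exponential
  changes by \<open>exp (\<mp> 2 * pi * v * Y)\<close> and the sine contributes \<open>1 / sinh (pi * Y)\<close>.  The last summand is the
  contribution of the vertical sides and tends to 0 with \<open>n\<close>.
\<close>
lemma gaussian_sinc_kernel_bound:
  fixes x v s Y :: real and n :: nat
  assumes xn: "\<bar>x\<bar> < real n + 1 / 2" and s: "s > 0" and Y: "Y > 0"
  shows "cmod (cis (2 * pi * v * x) - (\<Sum>l\<in>{- int n..int n}.
            of_real (sinc (pi * (x - of_int l)) * exp (- (x - of_int l)\<^sup>2 / (2 * s\<^sup>2))) * cis (2 * pi * v * of_int l)))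
       \<le> s / (sqrt (2 * pi) * Y * sinh (pi * Y)) * exp (Y\<^sup>2 / (2 * s\<^sup>2)) *
            (exp (2 * pi * v * Y) + exp (- (2 * pi * v * Y)))
         + 2 * Y / (pi * (real n + 1 / 2 - \<bar>x\<bar>)) *
            exp (2 * pi * \<bar>v\<bar> * Y + Y\<^sup>2 / (2 * s\<^sup>2))"
    (is "cmod (_ - (\<Sum>l\<in>?I. of_real (?c l) * _)) \<le> ?H + ?V")
proof (cases "x \<in> \<int>")
  case True
  \<comment> \<open>At an integer all terms but one vanish and the partial sum is exact.\<close>
  then obtain k where k: "x = of_int k" by (auto elim: Ints_cases)
  have sinh: "0 < sinh (pi * Y)" using Y by simp
  have pos: "0 \<le> ?H + ?V"
    using xn s Y sinh by (intro add_nonneg_nonneg mult_nonneg_nonneg divide_nonneg_nonneg) auto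
  have "sinc (pi * (of_int k - of_int l)) = 0" if "l \<noteq> k" for l :: int
  proof -
    have "sin (pi * of_int (k - l)) = 0" using sin_zero_iff_int2 mult.commute by metis
    then show ?thesis using that by simp
  qed
  then have "(\<Sum>l\<in>?I. of_real (?c l) * cis (2 * pi * v * of_int l))
     = (\<Sum>l\<in>?I. if l = k then cis (2 * pi * v * x) else 0)"
    unfolding k by (intro sum.cong refl) auto
  also have "\<dots> = cis (2 * pi * v * x)"
    using xn k by (subst sum.delta) auto
  finally show ?thesis using pos by simp
next
  case False
  define R where "R = real n + 1 / 2"
  define E where "E = (\<lambda>z. exp (2 * of_real pi * \<i> * of_real v * z - (z - of_real x)\<^sup>2 / (2 * (of_real s)\<^sup>2)))"
  define W where "W = (\<lambda>z. E z / ((z - of_real x) * sin (of_real pi * z)))"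
  have hol: "E holomorphic_on A" for A
    unfolding E_def using s by (intro holomorphic_intros) auto
  have Ere: "E (of_real y) = of_real (exp (- (x - y)\<^sup>2 / (2 * s\<^sup>2))) * cis (2 * pi * v * y)" for y
    unfolding E_def cis_conv_exp exp_of_real[symmetric] exp_add[symmetric]
    by (simp add: algebra_simps power2_commute)
  have nE: "cmod (E z) = exp (- (2 * pi * v * Im z) - ((Re z - x)\<^sup>2 - (Im z)\<^sup>2) / (2 * s\<^sup>2))" for z
  proof -
    have "2 * (complex_of_real s)\<^sup>2 = of_real (2 * s\<^sup>2)" by simp
    then have "Re ((z - of_real x)\<^sup>2 / (2 * (of_real s)\<^sup>2)) = ((Re z - x)\<^sup>2 - (Im z)\<^sup>2) / (2 * s\<^sup>2)"
      by (simp only: Re_divide_of_real) (simp add: power2_eq_square)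
    then show ?thesis unfolding E_def by simp
  qed
  have sinh: "0 < sinh (pi * Y)" using Y by simp
  define D where "D = R - \<bar>x\<bar>"
  have D: "D > 0" using xn by (simp add: D_def R_def)
  have sinY: "sinh (pi * Y) \<le> cmod (sin (of_real pi * z))" if "\<bar>Im z\<bar> = Y" for z
  proof -
    have "\<bar>sinh (pi * Im z)\<bar> = sinh (pi * Y)"
      using that Y sinh by (cases "Im z \<ge> 0") (auto simp: abs_if mult_less_0_iff)
    then show ?thesis using cmod_sin_ge_sinh[of "of_real pi * z"] by simp
  qed
  have sinR: "1 \<le> cmod (sin (of_real pi * z))" if "\<bar>Re z\<bar> = R" for z
  proof -
    have "Re (of_real pi * z) = pi * (of_int (if Re z \<ge> 0 then int n else - int n - 1) + 1 / 2)"
      using that by (auto simp: R_def)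
    then show ?thesis by (rule cmod_sin_half_integer_ge)
  qed
  \<comment> \<open>The lines that carry the sides of the rectangle; none of them meets a pole.\<close>
  define \<Gamma> where "\<Gamma> = {z. \<bar>Im z\<bar> = Y} \<union> {z. \<bar>Re z\<bar> = R}"
  have "(z - of_real x) * sin (of_real pi * z) \<noteq> 0" if "z \<in> \<Gamma>" for z
  proof -
    have "sin (of_real pi * z) \<noteq> 0"
      using that sinY[of z] sinR[of z] sinh unfolding \<Gamma>_def by auto
    moreover have "z \<noteq> of_real x"
      using that Y xn unfolding \<Gamma>_def R_def by auto
    ultimately show ?thesis by simp
  qed
  then have contW: "continuous_on A W" if "A \<subseteq> \<Gamma>" for A
    unfolding W_def using that
    by (intro continuous_intros holomorphic_on_imp_continuous_on hol) auto
  define z1 z2 z3 z4 where "z1 = Complex (- R) (- Y)" and "z2 = Complex R (- Y)"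
    and "z3 = Complex R Y" and "z4 = Complex (- R) Y"
  note zd = z1_def z2_def z3_def z4_def
  have seg: "closed_segment z1 z2 \<subseteq> \<Gamma>" "closed_segment z2 z3 \<subseteq> \<Gamma>"
      "closed_segment z4 z3 \<subseteq> \<Gamma>" "closed_segment z1 z4 \<subseteq> \<Gamma>"
    using Y by (auto simp: zd \<Gamma>_def closed_segment_same_Im closed_segment_same_Re R_def)
  then have ints: "W contour_integrable_on linepath z1 z2" "W contour_integrable_on linepath z2 z3"
      "W contour_integrable_on linepath z3 z4" "W contour_integrable_on linepath z4 z1"
    by (auto intro!: contour_integrable_continuous_linepath contW simp: closed_segment_commute)
  have "contour_integral (rectpath z1 z3) W
     = contour_integral (linepath z1 z2) W + contour_integral (linepath z2 z3) W
       + contour_integral (linepath z3 z4) W + contour_integral (linepath z4 z1) W"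
    using ints by (simp add: rectpath_def Let_def zd contour_integrable_join)
  also have "\<dots> = contour_integral (linepath z1 z2) W + contour_integral (linepath z2 z3) W
       - contour_integral (linepath z4 z3) W + contour_integral (linepath z4 z1) W"
    using seg by (subst contour_integral_reverse_linepath[of z4 z3]) (auto intro!: contW)
  finally have rect: "contour_integral (rectpath z1 z3) W
     = contour_integral (linepath z1 z2) W + contour_integral (linepath z2 z3) W
       - contour_integral (linepath z4 z3) W + contour_integral (linepath z4 z1) W" .
  have "cmod (a + b - c + d) \<le> cmod a + cmod b + cmod c + cmod d" for a b c d :: complex
    by (smt (verit) norm_triangle_ineq norm_triangle_ineq4)
  then have split: "cmod (contour_integral (rectpath z1 z3) W)
     \<le> cmod (contour_integral (linepath z1 z2) W) + cmod (contour_integral (linepath z2 z3) W)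
       + cmod (contour_integral (linepath z4 z3) W) + cmod (contour_integral (linepath z4 z1) W)"
    unfolding rect .

  \<comment> \<open>Both horizontal sides at once: \<open>c\<close> is \<open>Y\<close> or \<open>- Y\<close>.\<close>
  have horiz: "cmod (contour_integral (linepath (Complex (- R) c) (Complex R c)) W)
      \<le> exp (Y\<^sup>2 / (2 * s\<^sup>2)) * exp (- (2 * pi * v * c)) / (Y * sinh (pi * Y)) * (s * sqrt (2 * pi))"
    if c: "\<bar>c\<bar> = Y" for c
  proof (rule contour_integral_gaussian_bound[where x = x])
    show "continuous_on (closed_segment (Complex (- R) c) (Complex R c)) W"
      using c by (intro contW) (auto simp: \<Gamma>_def closed_segment_same_Im)
    fix u
    let ?z = "Complex u c"
    have "c\<^sup>2 = Y\<^sup>2" using c by (metis power2_abs)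
    then have "cmod (E ?z) = exp (Y\<^sup>2 / (2 * s\<^sup>2)) * exp (- (2 * pi * v * c)) * exp (- (u - x)\<^sup>2 / (2 * s\<^sup>2))"
      unfolding nE by (simp add: diff_divide_distrib flip: exp_add)
    moreover have "Y * sinh (pi * Y) \<le> cmod (?z - of_real x) * cmod (sin (of_real pi * ?z))"
      using sinY[of ?z] c sinh abs_Im_le_cmod[of "?z - of_real x"] Y by (intro mult_mono) auto
    moreover have "0 < Y * sinh (pi * Y)" using Y sinh by simp
    ultimately show "cmod (W ?z) \<le> exp (Y\<^sup>2 / (2 * s\<^sup>2)) * exp (- (2 * pi * v * c)) / (Y * sinh (pi * Y)) *
        exp (- (u - x)\<^sup>2 / (2 * s\<^sup>2))"
      unfolding W_def norm_divide norm_mult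
      unfolding times_divide_eq_left by (intro frac_le) simp_all
  qed (use s Y sinh in \<open>auto simp: R_def\<close>)

  let ?B = "exp (2 * pi * \<bar>v\<bar> * Y + Y\<^sup>2 / (2 * s\<^sup>2)) / D"
  have vert: "cmod (contour_integral (linepath a b) W) \<le> ?B * (2 * Y)"
    if r: "Re a = Re b" "\<bar>Re a\<bar> = R" and i: "\<bar>Im a\<bar> = Y" "Im b = - Im a" for a b
  proof -
    have ab: "a = Complex (Re a) (Im a)" "b = Complex (Re a) (- Im a)"
      using r i by (auto simp: complex_eq_iff)
    have "cmod (contour_integral (linepath a b) W) \<le> ?B * cmod (b - a)"
    proof (rule contour_integral_bound_linepath)
      have sub: "closed_segment a b \<subseteq> \<Gamma>"
        using r by (auto simp: \<Gamma>_def closed_segment_same_Re)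
      then show "W contour_integrable_on linepath a b"
        by (intro contour_integrable_continuous_linepath contW)
      show "0 \<le> ?B" using D by simp
      fix z assume "z \<in> closed_segment a b"
      then have z: "Re z = Re a" "\<bar>Im z\<bar> \<le> Y"
        using r i by (auto simp: closed_segment_same_Re closed_segment_eq_real_ivl split: if_splits)
      have Dz: "D \<le> \<bar>Re z - x\<bar>" using z r by (auto simp: D_def)
      have "\<bar>v * Im z\<bar> \<le> \<bar>v\<bar> * Y" using z by (simp add: abs_mult mult_left_mono)
      then have "- (v * Im z) \<le> \<bar>v\<bar> * Y" by linarith
      then have "2 * pi * - (v * Im z) \<le> 2 * pi * (\<bar>v\<bar> * Y)" by (intro mult_left_mono) auto
      moreover have "(Im z)\<^sup>2 / (2 * s\<^sup>2) \<le> Y\<^sup>2 / (2 * s\<^sup>2)"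
        using z Y by (intro divide_right_mono) (simp_all flip: abs_le_square_iff)
      moreover have "0 \<le> (Re z - x)\<^sup>2 / (2 * s\<^sup>2)" by simp
      ultimately have "cmod (E z) \<le> exp (2 * pi * \<bar>v\<bar> * Y + Y\<^sup>2 / (2 * s\<^sup>2))"
        unfolding nE diff_divide_distrib mult.assoc exp_le_cancel_iff by linarith
      moreover have "D * 1 \<le> cmod (z - of_real x) * cmod (sin (of_real pi * z))"
        using Dz D abs_Re_le_cmod[of "z - of_real x"] sinR[of z] z r by (intro mult_mono) auto
      ultimately show "cmod (W z) \<le> ?B"
        unfolding W_def norm_divide norm_mult using D by (intro frac_le) auto
    qed
    also have "cmod (b - a) = 2 * Y"
      using r i by (auto simp: cmod_def real_sqrt_mult)
    finally show ?thesis .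
  qed

  have "cis (2 * pi * v * x) - (\<Sum>l\<in>?I. of_real (?c l) * cis (2 * pi * v * of_int l))
      = E (of_real x) - (\<Sum>l\<in>?I. of_real (sinc (pi * (x - of_int l))) * E (of_int l))"
  proof -
    have "E (of_real x) = cis (2 * pi * v * x)" unfolding Ere by simp
    moreover have "of_real (sinc (pi * (x - of_int l))) * E (of_int l)
        = of_real (?c l) * cis (2 * pi * v * of_int l)" for l
      using Ere[of "of_int l"] by (simp only: of_real_of_int_eq of_real_mult mult.assoc)
    ultimately show ?thesis by (simp only:)
  qed
  also have "\<dots> = of_real (sin (pi * x)) / (2 * of_real pi * \<i>) * contour_integral (rectpath z1 z3) W"
    unfolding zd R_def W_def by (rule sinc_interpolation_remainder[OF hol False xn Y])
  also have "cmod \<dots> = \<bar>sin (pi * x)\<bar> / (2 * pi) * cmod (contour_integral (rectpath z1 z3) W)"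
    by (simp add: norm_mult norm_divide)
  also have "\<dots> \<le> 1 / (2 * pi) * cmod (contour_integral (rectpath z1 z3) W)"
    by (intro mult_right_mono divide_right_mono) auto
  also have "\<dots> \<le> 1 / (2 * pi) *
     (exp (Y\<^sup>2 / (2 * s\<^sup>2)) * exp (2 * pi * v * Y) / (Y * sinh (pi * Y)) * (s * sqrt (2 * pi)) + ?B * (2 * Y)
      + exp (Y\<^sup>2 / (2 * s\<^sup>2)) * exp (- (2 * pi * v * Y)) / (Y * sinh (pi * Y)) * (s * sqrt (2 * pi)) + ?B * (2 * Y))"
    using Y s by (intro mult_left_mono order_trans[OF split] add_mono
        order_trans[OF horiz[of "- Y", folded zd]] order_trans[OF horiz[of Y, folded zd]] vert)
      (auto simp: zd R_def)
  also have "\<dots> = ?H + ?V"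
  proof -
    have "sqrt (2 * pi) / (2 * pi) = 1 / sqrt (2 * pi)"
      by (simp add: real_div_sqrt field_simps)
    then have "1 / (2 * pi) * (e * f / (Y * S) * (s * sqrt (2 * pi)) + B / D * (2 * Y)
        + e * g / (Y * S) * (s * sqrt (2 * pi)) + B / D * (2 * Y))
       = s / (sqrt (2 * pi) * Y * S) * e * (f + g) + 2 * Y / (pi * D) * B" for e f g S B
      using Y D by (simp add: divide_simps) (simp add: algebra_simps)
    then show ?thesis unfolding D_def R_def by this
  qed
  finally show ?thesis .
qed

section \<open>Samples far from the point of evaluation\<close>

lemma sum_powers_le_geometric:
  fixes q :: real
  assumes q: "0 \<le> q" "q < 1" and A: "finite A" "inj_on (h :: 'a \<Rightarrow> nat) A"
  shows "(\<Sum>l\<in>A. q ^ h l) \<le> 1 / (1 - q)"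
proof -
  have "(\<Sum>l\<in>A. q ^ h l) = (\<Sum>j\<in>h ` A. q ^ j)"
    using A by (simp add: sum.reindex)
  also have "\<dots> \<le> (\<Sum>j. q ^ j)"
    using q A by (intro sum_le_suminf summable_geometric) auto
  also have "\<dots> = 1 / (1 - q)" using q by (simp add: suminf_geometric)
  finally show ?thesis .
qed

text \<open>
  Beyond distance \<open>m\<close> the Gaussian decays at least by the factor \<open>q = exp (- 2 * m / s\<^sup>2)\<close> per unit, so each side is
  bounded by a geometric series with first term \<open>p\<close> or \<open>p'\<close>.  The two nearest integers outside \<open>{x - m..x + m}\<close>
  differ by more than \<open>2 * m\<close>, hence by at least \<open>2 * m + 1\<close>.  This means \<open>p * p' \<le> q\<close>, and \<open>(1 - p) * (1 - p') \<ge> 0\<close>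
  gives \<open>p + p' \<le> 1 + q\<close> instead of the trivial bound 2.
\<close>
lemma gaussian_far_sum_le:
  fixes x s :: real and m :: nat
  assumes s: "s > 0" and m: "m > 0" and A: "finite A" "\<And>l. l \<in> A \<Longrightarrow> real m < \<bar>x - of_int l\<bar>"
  shows "(\<Sum>l\<in>A. exp (- (x - of_int l)\<^sup>2 / s\<^sup>2)) \<le> exp (- (real m)\<^sup>2 / s\<^sup>2) * (1 + s\<^sup>2 / real m)"
proof -
  define y where "y = 2 * real m / s\<^sup>2"
  define q where "q = exp (- y)"
  define k where "k = \<lfloor>x + real m\<rfloor> + 1"
  define k' where "k' = \<lceil>x - real m\<rceil> - 1"
  define p where "p = exp (- y * (of_int k - x - real m))"
  define p' where "p' = exp (- y * (x - real m - of_int k'))"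
  define G where "G = exp (- (real m)\<^sup>2 / s\<^sup>2)"
  have y: "y > 0" using s m by (simp add: y_def)
  have q: "0 < q" "q < 1" using y by (auto simp: q_def)
  \<comment> \<open>The tangent to the parabola \<open>u\<^sup>2\<close> at \<open>u = m\<close> lies below it.\<close>
  have gauss: "exp (- u\<^sup>2 / s\<^sup>2) \<le> G * exp (- y * (u - real m))" for u
  proof -
    have "(real m)\<^sup>2 + 2 * real m * (u - real m) \<le> u\<^sup>2"
      using zero_le_power2[of "u - real m"] by (simp add: power2_eq_square algebra_simps)
    then have "((real m)\<^sup>2 + 2 * real m * (u - real m)) / s\<^sup>2 \<le> u\<^sup>2 / s\<^sup>2"
      by (rule divide_right_mono) simp
    then have "- u\<^sup>2 / s\<^sup>2 \<le> - (real m)\<^sup>2 / s\<^sup>2 + - y * (u - real m)"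
      by (simp add: y_def add_divide_distrib)
    then show ?thesis unfolding G_def by (simp flip: exp_add)
  qed
  define Ap where "Ap = {l \<in> A. x < of_int l}"
  define Am where "Am = {l \<in> A. \<not> x < of_int l}"
  have kp: "k \<le> l" if "l \<in> Ap" for l
  proof -
    have "x + real m < of_int l" using that A(2)[of l] by (auto simp: Ap_def)
    then have "\<lfloor>x + real m\<rfloor> < l" by (simp only: floor_less_iff)
    then show ?thesis by (simp add: k_def)
  qed
  have km: "l \<le> k'" if "l \<in> Am" for l
  proof -
    have "of_int l < x - real m" using that A(2)[of l] by (auto simp: Am_def)
    then have "l < \<lceil>x - real m\<rceil>" by (simp only: less_ceiling_iff)
    then show ?thesis by (simp add: k'_def)
  qed
  have "(\<Sum>l\<in>Ap. exp (- (x - of_int l)\<^sup>2 / s\<^sup>2)) \<le> (\<Sum>l\<in>Ap. G * p * q ^ nat (l - k))"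
  proof (rule sum_mono)
    fix l assume "l \<in> Ap"
    then have "real (nat (l - k)) = of_int l - of_int k" using kp by simp
    then have "p * q ^ nat (l - k) = exp (- y * ((of_int l - x) - real m))"
      unfolding p_def q_def exp_of_nat_mult[symmetric] exp_add[symmetric] by (simp add: algebra_simps)
    then show "exp (- (x - of_int l)\<^sup>2 / s\<^sup>2) \<le> G * p * q ^ nat (l - k)"
      using gauss[of "of_int l - x"] by (simp add: power2_commute mult.assoc)
  qed
  also have "\<dots> = G * p * (\<Sum>l\<in>Ap. q ^ nat (l - k))" by (simp add: sum_distrib_left)
  also have "\<dots> \<le> G * p * (1 / (1 - q))"
  proof (intro mult_left_mono sum_powers_le_geometric)
    show "inj_on (\<lambda>l. nat (l - k)) Ap"
    proof (rule inj_onI)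
      fix a b assume "a \<in> Ap" "b \<in> Ap" "nat (a - k) = nat (b - k)"
      then show "a = b" using kp[of a] kp[of b] by linarith
    qed
  qed (use q A in \<open>auto simp: Ap_def G_def p_def\<close>)
  finally have 1: "(\<Sum>l\<in>Ap. exp (- (x - of_int l)\<^sup>2 / s\<^sup>2)) \<le> G * p * (1 / (1 - q))" .
  have "(\<Sum>l\<in>Am. exp (- (x - of_int l)\<^sup>2 / s\<^sup>2)) \<le> (\<Sum>l\<in>Am. G * p' * q ^ nat (k' - l))"
  proof (rule sum_mono)
    fix l assume "l \<in> Am"
    then have "real (nat (k' - l)) = of_int k' - of_int l" using km by simp
    then have "p' * q ^ nat (k' - l) = exp (- y * ((x - of_int l) - real m))"
      unfolding p'_def q_def exp_of_nat_mult[symmetric] exp_add[symmetric] by (simp add: algebra_simps)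
    then show "exp (- (x - of_int l)\<^sup>2 / s\<^sup>2) \<le> G * p' * q ^ nat (k' - l)"
      using gauss[of "x - of_int l"] by (simp add: mult.assoc)
  qed
  also have "\<dots> = G * p' * (\<Sum>l\<in>Am. q ^ nat (k' - l))" by (simp add: sum_distrib_left)
  also have "\<dots> \<le> G * p' * (1 / (1 - q))"
  proof (intro mult_left_mono sum_powers_le_geometric)
    show "inj_on (\<lambda>l. nat (k' - l)) Am"
    proof (rule inj_onI)
      fix a b assume "a \<in> Am" "b \<in> Am" "nat (k' - a) = nat (k' - b)"
      then show "a = b" using km[of a] km[of b] by linarith
    qed
  qed (use q A in \<open>auto simp: Am_def G_def p'_def\<close>)
  finally have 2: "(\<Sum>l\<in>Am. exp (- (x - of_int l)\<^sup>2 / s\<^sup>2)) \<le> G * p' * (1 / (1 - q))" .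
  have "p + p' \<le> 1 + q"
  proof -
    have kx: "x + real m < of_int k" "of_int k' < x - real m"
      unfolding k_def k'_def by linarith+
    then have "of_int (k' + 2 * int m) < (of_int k :: real)" by simp
    then have "k' + 2 * int m < k" by (simp only: of_int_less_iff)
    then have "of_int (k' + 2 * int m + 1) \<le> (of_int k :: real)" by (simp only: of_int_le_iff)
    then have "1 \<le> of_int k - of_int k' - 2 * real m" by simp
    then have "y * 1 \<le> y * (of_int k - of_int k' - 2 * real m)" using y by (intro mult_left_mono) auto
    then have "p * p' \<le> q"
      unfolding p_def p'_def q_def exp_add[symmetric] by (simp add: algebra_simps)
    moreover have "p \<le> 1" "p' \<le> 1"
      using kx y unfolding p_def p'_def by auto
    then have "0 \<le> (1 - p) * (1 - p')" by simp
    ultimately show ?thesis by (simp add: algebra_simps)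
  qed
  then have "G * (p + p') * (1 / (1 - q)) \<le> G * (1 + q) * (1 / (1 - q))"
    using q by (intro mult_right_mono mult_left_mono) (auto simp: G_def)
  also have "\<dots> = G * ((1 + q) / (1 - q))" by simp
  also have "\<dots> \<le> G * (1 + 2 / y)"
  proof (rule mult_left_mono)
    \<comment> \<open>The claim is equivalent to \<open>1 + y \<le> exp y\<close>.\<close>
    have "q * (1 + y) \<le> q * exp y" using q exp_ge_add_one_self[of y] by (intro mult_left_mono) auto
    also have "\<dots> = 1" by (simp add: q_def flip: exp_add)
    finally show "(1 + q) / (1 - q) \<le> 1 + 2 / y"
      using q y by (simp add: field_simps)
  qed (simp add: G_def)
  also have "2 / y = s\<^sup>2 / real m" using s m by (simp add: y_def)
  finally have 3: "G * (p + p') * (1 / (1 - q)) \<le> G * (1 + s\<^sup>2 / real m)" .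
  have "(\<Sum>l\<in>A. exp (- (x - of_int l)\<^sup>2 / s\<^sup>2))
      = (\<Sum>l\<in>Ap. exp (- (x - of_int l)\<^sup>2 / s\<^sup>2)) + (\<Sum>l\<in>Am. exp (- (x - of_int l)\<^sup>2 / s\<^sup>2))"
    unfolding Ap_def Am_def by (subst sum.union_disjoint[symmetric]) (auto simp: A intro: sum.cong)
  also have "\<dots> \<le> G * (p + p') * (1 / (1 - q))" using 1 2 by (simp add: distrib_left distrib_right add_divide_distrib)
  finally show ?thesis using 3 unfolding G_def by linarith
qed

lemma integral_cis_period:
  assumes L: "L > 0"
  shows "(LINT v|lborel. indicator {- (L / 2)..L / 2} v *\<^sub>R cis (2 * pi * v * of_int j / L))
       = (if j = 0 then of_real L else 0)"
proof (cases "j = 0")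
  case True
  then show ?thesis using L by (simp add: scaleR_conv_of_real)
next
  case False
  let ?\<omega> = "2 * pi * of_int j / L"
  have w: "?\<omega> \<noteq> 0" using False L by simp
  let ?F = "\<lambda>v. cis (?\<omega> * v) / (\<i> * of_real ?\<omega>)"
  have "(LINT v|lborel. indicator {- (L / 2)..L / 2} v *\<^sub>R cis (?\<omega> * v)) = ?F (L / 2) - ?F (- (L / 2))"
  proof (rule integral_FTC_atLeastAtMost)
    fix v
    have "((\<lambda>v. cis (?\<omega> * v)) has_vector_derivative ?\<omega> *\<^sub>R (\<i> * cis (?\<omega> * v))) (at v)"
      unfolding has_vector_derivative_def
      using L by (auto intro!: derivative_eq_intros simp: scaleR_conv_of_real mult_ac)
    then have "(?F has_vector_derivative (?\<omega> *\<^sub>R (\<i> * cis (?\<omega> * v))) / (\<i> * of_real ?\<omega>)) (at v)"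
      by (rule has_vector_derivative_divide)
    then show "(?F has_vector_derivative cis (?\<omega> * v)) (at v within {- (L / 2)..L / 2})"
      using w by (simp add: scaleR_conv_of_real has_vector_derivative_at_within)
  qed (use L in \<open>auto intro!: continuous_intros\<close>)
  also have "cis (?\<omega> * (L / 2)) = cis (?\<omega> * (- (L / 2)))"
  proof -
    have "?\<omega> * (L / 2) = ?\<omega> * (- (L / 2)) + 2 * pi * of_int j" using L by (simp add: field_simps)
    then have "cis (?\<omega> * (L / 2)) = cis (?\<omega> * (- (L / 2)) + 2 * pi * of_int j)" by (simp only:)
    also have "\<dots> = cis (?\<omega> * (- (L / 2)))" 
      by (simp only: cis_mult[symmetric] cis_multiple_2pi[OF Ints_of_int] mult_1_right)
    finally show ?thesis .
  qed
  finally show ?thesis using False by (simp add: mult_ac)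
qed

text \<open>
  Parseval's identity: the exponentials are orthogonal over an interval of length \<open>L\<close>.
\<close>
lemma trig_polynomial_L2:
  fixes c :: "int \<Rightarrow> real"
  assumes L: "L > 0" and A: "finite A"
  defines "h \<equiv> \<lambda>v. indicator {- (L / 2)..L / 2} v * (\<Sum>l\<in>A. of_real (c l) * cis (2 * pi * v * of_int l / L))"
  shows "in_L2 h" "(L2_norm h)\<^sup>2 = L * (\<Sum>l\<in>A. (c l)\<^sup>2)"
proof -
  let ?J = "{- (L / 2)..L / 2}"
  have int: "integrable lborel (\<lambda>v. indicator ?J v *\<^sub>R cis (2 * pi * v * of_int j / L))" for j :: int
    using L by (intro borel_integrable_compact continuous_intros) auto
  have sq: "complex_of_real ((cmod (h v))\<^sup>2)
      = (\<Sum>l\<in>A. \<Sum>k\<in>A. of_real (c l * c k) * (indicator ?J v *\<^sub>R cis (2 * pi * v * of_int (l - k) / L)))" for v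
  proof -
    have "cis (2 * pi * v * of_int l / L) * cnj (cis (2 * pi * v * of_int k / L))
       = cis (2 * pi * v * of_int (l - k) / L)" for l k
      by (simp add: cis_cnj cis_mult right_diff_distrib diff_divide_distrib)
    then show ?thesis
      unfolding complex_norm_square h_def
      by (cases "v \<in> ?J") (simp_all add: sum_product mult_ac)
  qed
  have int2: "integrable lborel (\<lambda>v. complex_of_real ((cmod (h v))\<^sup>2))"
    unfolding sq by (intro Bochner_Integration.integrable_sum integrable_mult_right int)
  have "h \<in> borel_measurable borel"
  proof -
    show ?thesis unfolding h_def by measurable
  qed
  moreover have "integrable lborel (\<lambda>v. (cmod (h v))\<^sup>2)"
    using int2 by (simp only: complex_of_real_integrable_eq)
  ultimately show "in_L2 h" by (simp add: in_L2_def)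
  have "complex_of_real ((L2_norm h)\<^sup>2) = (LINT v|lborel. complex_of_real ((cmod (h v))\<^sup>2))"
    by (simp only: L2_norm_power2 integral_complex_of_real)
  also have "\<dots> = (\<Sum>l\<in>A. \<Sum>k\<in>A. of_real (c l * c k) * (if l - k = 0 then of_real L else 0))"
    unfolding sq by (simp only: Bochner_Integration.integral_sum integral_mult_right_zero integral_cis_period[OF L] int
        Bochner_Integration.integrable_sum integrable_mult_right)
  also have "\<dots> = of_real (L * (\<Sum>l\<in>A. (c l)\<^sup>2))"
    using A by (simp add: if_distrib[of "(*) _"] sum.delta sum_distrib_left power2_eq_square mult_ac cong: if_cong)
  finally show "(L2_norm h)\<^sup>2 = L * (\<Sum>l\<in>A. (c l)\<^sup>2)" by (simp only: of_real_eq_iff)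
qed

section \<open>The pointwise error\<close>

text \<open>
  The cross term is removed by \<open>(a + b)\<^sup>2 \<le> 2 * (a\<^sup>2 + b\<^sup>2)\<close>.  For large \<open>k * d\<close> the bound is about \<open>sqrt (2 / k)\<close>
  times the maximum of the function, however large \<open>d\<close> is.
\<close>
lemma L2_norm_two_sided_exponential:
  assumes C: "C \<ge> 0" and k: "k > 0" and d: "d \<ge> 0"
  defines "h \<equiv> \<lambda>v. indicator {- d..d} v * complex_of_real (C * (exp (k * v) + exp (- (k * v))))"
  shows "in_L2 h" "L2_norm h \<le> C * sqrt (4 * sinh (2 * k * d) / k)"
proof -
  let ?w = "\<lambda>v. indicator {- d..d} v *\<^sub>R (C\<^sup>2 * (2 * (exp (2 * k * v) + exp (- (2 * k * v)))))"
  have le: "(cmod (h v))\<^sup>2 \<le> ?w v" for v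
  proof (cases "v \<in> {- d..d}")
    case True
    have "(exp (k * v) + exp (- (k * v)))\<^sup>2 \<le> 2 * ((exp (k * v))\<^sup>2 + (exp (- (k * v)))\<^sup>2)"
      using sum_squares_bound[of "exp (k * v)" "exp (- (k * v))"] by (simp add: power2_sum)
    also have "\<dots> = 2 * (exp (2 * k * v) + exp (- (2 * k * v)))"
      by (simp add: mult.assoc flip: exp_of_nat_mult)
    finally have "C\<^sup>2 * (exp (k * v) + exp (- (k * v)))\<^sup>2 \<le> C\<^sup>2 * \<dots>"
      by (rule mult_left_mono) simp
    moreover have "(cmod (h v))\<^sup>2 = C\<^sup>2 * (exp (k * v) + exp (- (k * v)))\<^sup>2"
      using True unfolding h_def by (simp add: norm_mult power_mult_distrib del: of_real_add of_real_mult)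
    ultimately show ?thesis using True by simp
  qed (simp add: h_def)
  have w: "integrable lborel ?w"
    by (intro borel_integrable_compact continuous_intros) auto
  have meas: "h \<in> borel_measurable borel" unfolding h_def by measurable
  then show h: "in_L2 h" unfolding in_L2_def using le
    by (auto intro!: Bochner_Integration.integrable_bound[OF w] AE_I2 intro: order_trans[OF _ abs_ge_self])
  have "(L2_norm h)\<^sup>2 \<le> (LINT v|lborel. ?w v)"
    unfolding L2_norm_power2 by (intro integral_mono in_L2D h w le)
  also have "\<dots> = C\<^sup>2 * ((exp (2 * k * d) - exp (- (2 * k * d))) / k)
      - C\<^sup>2 * ((exp (2 * k * (- d)) - exp (- (2 * k * (- d)))) / k)"
    using d k
    by (intro integral_FTC_atLeastAtMost)
      (auto intro!: continuous_intros derivative_eq_intros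
        simp: has_real_derivative_iff_has_vector_derivative[symmetric] field_simps)
  also have "\<dots> = C\<^sup>2 * (4 * sinh (2 * k * d) / k)"
    using k by (simp add: sinh_def divide_simps) (simp add: algebra_simps)
  also have "\<dots> = (C * sqrt (4 * sinh (2 * k * d) / k))\<^sup>2"
    using k d by (simp add: power_mult_distrib)
  finally show "L2_norm h \<le> C * sqrt (4 * sinh (2 * k * d) / k)"
    by (rule power2_le_imp_le) (use C k d in simp)
qed

lemma finite_near_ints: "finite {l::int. \<bar>x - of_int l\<bar> \<le> r}" for r :: real
proof (rule finite_subset)
  show "{l::int. \<bar>x - of_int l\<bar> \<le> r} \<subseteq> {\<lfloor>x - r\<rfloor>..\<lceil>x + r\<rceil>}"
    by (auto simp: abs_le_iff) linarith+
qed simp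

lemma reg_shannon_support_iff:
  assumes L: "L > (0::real)"
  shows "t - of_int l / L \<in> {- (real m / L)..real m / L} \<longleftrightarrow> \<bar>L * t - of_int l\<bar> \<le> real m"
proof -
  have "t - of_int l / L = (L * t - of_int l) / L" using L by (simp add: field_simps)
  then show ?thesis using L by (auto simp: abs_le_iff pos_le_divide_eq divide_le_cancel)
qed

text \<open>
  The freedom in \<open>J\<close> lets one index set serve all \<open>t\<close> near a given point.
\<close>
lemma reg_shannon_eq_sum_superset:
  assumes L: "L > 0" and J: "finite J" "{l. \<bar>L * t - of_int l\<bar> \<le> real m} \<subseteq> J"
  shows "reg_shannon \<phi> L m f t = (\<Sum>l\<in>J. f (of_int l / L) *
        of_real (sinc (L * pi * (t - of_int l / L)) * \<phi> (t - of_int l / L) *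
                 indicator {- (real m / L)..real m / L} (t - of_int l / L)))"
proof -
  have "indicat_real {- (real m / L)..real m / L} (t - of_int l / L) = 0" if "l \<notin> J" for l
  proof (rule indicator_simps(2))
    show "t - of_int l / L \<notin> {- (real m / L)..real m / L}"
      using that J(2) unfolding reg_shannon_support_iff[OF L] by blast
  qed
  then show ?thesis
    unfolding reg_shannon_def
    by (subst infsum_finite[OF J(1), symmetric], intro infsum_cong_neutral) simp_all
qed

lemma reg_shannon_eq_sum:
  assumes L: "L > 0"
  shows "reg_shannon \<phi> L m f t = (\<Sum>l | \<bar>L * t - of_int l\<bar> \<le> real m.
           f (of_int l / L) * of_real (sinc (pi * (L * t - of_int l)) * \<phi> (t - of_int l / L)))"
proof -
  have "L * pi * (t - of_int l / L) = pi * (L * t - of_int l)" for l :: int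
    using L by (simp add: field_simps)
  then show ?thesis
    using reg_shannon_support_iff[OF L, of t _ m]
    by (subst reg_shannon_eq_sum_superset[OF L finite_near_ints order_refl], intro sum.cong refl)
       (simp only: mem_Collect_eq indicator_simps mult_1_right)
qed

text \<open>
  For large \<open>n\<close> the error at \<open>t\<close> splits into the error of the symmetric partial sum up to \<open>n\<close>, which is \<open>g\<close> integrated
  against the kernel \<open>k n\<close>, and the sum over those samples up to \<open>n\<close> that the window cuts off.  Working
  with finite sums throughout avoids any question of convergence of the sampling series.  The first
  summand on the right-hand side bounds \<open>k n\<close> up to a term that vanishes with \<open>n\<close>, and the second bounds the norm of
  the cut-off part.
\<close>
lemma gauss_shannon_pointwise_error:
  fixes f g :: "real \<Rightarrow> complex" and \<delta> L \<sigma> :: real and m :: nat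
  assumes g: "in_L2 g" "integrable lborel g" "\<And>v. v \<notin> {- \<delta>..\<delta>} \<Longrightarrow> g v = 0"
    and fg: "\<And>t. f t = (LINT v|lborel. g v * cis (2 * pi * t * v))"
    and \<delta>: "0 \<le> \<delta>" "2 * \<delta> < L" and \<sigma>: "\<sigma> > 0" and m: "m \<ge> 1"
  defines "s \<equiv> \<sigma> * L"
  shows "cmod (f t - reg_shannon (gauss_window \<sigma>) L m f t)
    \<le> L2_norm g * (s / (sqrt (2 * pi) * real m * sinh (pi * real m)) * exp ((real m)\<^sup>2 / (2 * s\<^sup>2)) *
                     sqrt (2 * L * sinh (4 * pi * real m * \<delta> / L) / (pi * real m))
                   + sqrt (L * (exp (- (real m)\<^sup>2 / s\<^sup>2) * (1 + s\<^sup>2 / real m))) / (pi * real m))"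
    (is "_ \<le> L2_norm g * (?H + ?T)")
proof -
  have L: "L > 0" using \<delta> by linarith
  have s: "s > 0" using \<sigma> L by (simp add: s_def)
  define x where "x = L * t"
  define c where "c = (\<lambda>l::int. sinc (pi * (x - of_int l)) * exp (- (x - of_int l)\<^sup>2 / (2 * s\<^sup>2)))"
  define I where "I = (\<lambda>n::nat. {- int n..int n})"
  define near where "near = {l::int. \<bar>x - of_int l\<bar> \<le> real m}"
  define e where "e = (\<lambda>(l::int) v. cis (2 * pi * v * of_int l / L))"
  define k where "k = (\<lambda>n v. cis (2 * pi * t * v) - (\<Sum>l\<in>I n. of_real (c l) * e l v))"
  define C where "C = s / (sqrt (2 * pi) * real m * sinh (pi * real m)) * exp ((real m)\<^sup>2 / (2 * s\<^sup>2))"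
  define \<kappa> where "\<kappa> = 2 * pi * real m / L"
  define h where "h = (\<lambda>v. indicator {- \<delta>..\<delta>} v * complex_of_real (C * (exp (\<kappa> * v) + exp (- (\<kappa> * v)))))"
  define V where "V = (\<lambda>n::nat. 2 * real m / (pi * (real n + 1 / 2 - \<bar>x\<bar>)) *
      exp (2 * pi * (\<delta> / L) * real m + (real m)\<^sup>2 / (2 * s\<^sup>2)))"
  have C: "C \<ge> 0" using s m by (simp add: C_def)
  have \<kappa>: "\<kappa> > 0" using m L by (simp add: \<kappa>_def)
  note h = L2_norm_two_sided_exponential[OF C \<kappa> \<delta>(1), folded h_def]
  have [measurable]: "g \<in> borel_measurable borel" using g(1) by (rule in_L2D)

  have kbound: "cmod (k n v) \<le> cmod (h v) + V n" if n: "\<bar>x\<bar> < real n + 1 / 2" and v: "v \<in> {- \<delta>..\<delta>}" for n v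
  proof -
    have "cmod (cis (2 * pi * (v / L) * x) - (\<Sum>l\<in>{- int n..int n}.
        of_real (sinc (pi * (x - of_int l)) * exp (- (x - of_int l)\<^sup>2 / (2 * s\<^sup>2))) * cis (2 * pi * (v / L) * of_int l)))
      \<le> C * (exp (2 * pi * (v / L) * real m) + exp (- (2 * pi * (v / L) * real m)))
        + 2 * real m / (pi * (real n + 1 / 2 - \<bar>x\<bar>)) * exp (2 * pi * \<bar>v / L\<bar> * real m + (real m)\<^sup>2 / (2 * s\<^sup>2))"
      unfolding C_def using m by (intro gaussian_sinc_kernel_bound n s) simp
    moreover have "cis (2 * pi * (v / L) * x) = cis (2 * pi * t * v)"
      using L by (simp add: x_def mult_ac)
    moreover have "cis (2 * pi * (v / L) * of_int l) = e l v" for l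
      by (simp add: e_def)
    moreover have "2 * pi * (v / L) * real m = \<kappa> * v" by (simp add: \<kappa>_def)
    moreover have "cmod (h v) = C * (exp (\<kappa> * v) + exp (- (\<kappa> * v)))"
    proof -
      have "0 \<le> C * (exp (\<kappa> * v) + exp (- (\<kappa> * v)))"
        using C by (intro mult_nonneg_nonneg add_nonneg_nonneg) auto
      then show ?thesis
        using v unfolding h_def by (simp add: norm_mult del: of_real_add of_real_mult)
    qed
    moreover have "2 * real m / (pi * (real n + 1 / 2 - \<bar>x\<bar>)) * exp (2 * pi * \<bar>v / L\<bar> * real m + (real m)\<^sup>2 / (2 * s\<^sup>2)) \<le> V n"
      unfolding V_def using n v L
      by (intro mult_left_mono iffD2[OF exp_le_cancel_iff] add_mono mult_right_mono)
        (auto simp: abs_le_iff intro!: divide_nonneg_nonneg mult_nonneg_nonneg divide_right_mono)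
    ultimately show ?thesis
      unfolding k_def I_def c_def by (simp only:)
  qed

  have gbdd: "integrable lborel (\<lambda>v. g v * cis (u * v))" for u
    by (rule Bochner_Integration.integrable_bound[OF g(2)]) (auto simp: norm_mult)
  have ge: "integrable lborel (\<lambda>v. g v * e l v)" for l
    using gbdd[of "2 * pi * of_int l / L"] by (simp add: e_def mult_ac)
  have fl: "f (of_int l / L) = (LINT v|lborel. g v * e l v)" for l
    unfolding fg e_def by (simp add: mult_ac)
  have gk: "integrable lborel (\<lambda>v. g v * k n v)" for n
    unfolding k_def right_diff_distrib sum_distrib_left mult.left_commute[of "g _"]
    using gbdd[of "2 * pi * t"]
    by (intro Bochner_Integration.integrable_diff Bochner_Integration.integrable_sum integrable_mult_right ge) auto

  have main: "cmod (f t - reg_shannon (gauss_window \<sigma>) L m f t)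
      \<le> L2_norm g * (?H + ?T) + V n * (LINT v|lborel. cmod (g v))"
    if n: "\<bar>x\<bar> + real m \<le> real n" for n
  proof -
    have nx: "\<bar>x\<bar> < real n + 1 / 2" using n by linarith
    have "near \<subseteq> I n" using n unfolding near_def I_def by (auto; linarith)
    then have split: "(\<Sum>l\<in>near. of_real (c l) * f (of_int l / L))
       = (\<Sum>l\<in>I n. of_real (c l) * f (of_int l / L)) - (\<Sum>l\<in>I n - near. of_real (c l) * f (of_int l / L))"
      by (subst sum.subset_diff[of near "I n"]) (auto simp: I_def)
    have gw: "gauss_window \<sigma> (t - of_int l / L) = exp (- (x - of_int l)\<^sup>2 / (2 * s\<^sup>2))" for l :: int
    proof -
      have "t - of_int l / L = (x - of_int l) / L" using L by (simp add: x_def field_simps)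
      then show ?thesis by (simp add: gauss_window_def s_def power_divide power_mult_distrib mult_ac)
    qed
    have "reg_shannon (gauss_window \<sigma>) L m f t = (\<Sum>l\<in>near. of_real (c l) * f (of_int l / L))"
      unfolding reg_shannon_eq_sum[OF L] near_def c_def gw x_def by (simp only: mult.commute)
    then have "f t - reg_shannon (gauss_window \<sigma>) L m f t
      = (f t - (\<Sum>l\<in>I n. of_real (c l) * f (of_int l / L))) + (\<Sum>l\<in>I n - near. of_real (c l) * f (of_int l / L))"
      using split by simp
    also have "f t - (\<Sum>l\<in>I n. of_real (c l) * f (of_int l / L)) = (LINT v|lborel. g v * k n v)"
      unfolding k_def right_diff_distrib sum_distrib_left mult.left_commute[of "g _"] fl fg[of t]
      using gbdd[of "2 * pi * t"] ge
      by (subst Bochner_Integration.integral_diff) (auto simp: Bochner_Integration.integral_sum)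
    finally have dec: "cmod (f t - reg_shannon (gauss_window \<sigma>) L m f t)
       \<le> cmod (LINT v|lborel. g v * k n v) + cmod (\<Sum>l\<in>I n - near. of_real (c l) * f (of_int l / L))"
      by (simp only: norm_triangle_ineq)
    have "cmod (LINT v|lborel. g v * k n v) \<le> (LINT v|lborel. cmod (g v) * cmod (h v) + V n * cmod (g v))"
    proof (rule order_trans[OF integral_norm_bound integral_mono])
      fix v show "norm (g v * k n v) \<le> cmod (g v) * cmod (h v) + V n * cmod (g v)"
      proof (cases "v \<in> {- \<delta>..\<delta>}")
        case True
        then show ?thesis
          using mult_left_mono[OF kbound[OF nx True], of "cmod (g v)"] by (simp add: norm_mult algebra_simps)
      qed (simp add: g(3))
    qed (use gk g h integrable_norm_mult_in_L2 in auto)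
    also have "\<dots> = (LINT v|lborel. cmod (g v) * cmod (h v)) + V n * (LINT v|lborel. cmod (g v))"
      using g h integrable_norm_mult_in_L2 by simp
    also have "(LINT v|lborel. cmod (g v) * cmod (h v)) \<le> L2_norm g * L2_norm h"
      by (rule L2_Cauchy_Schwarz_norm[OF g(1) h(1)])
    also have "L2_norm g * L2_norm h \<le> L2_norm g * ?H"
    proof (rule mult_left_mono[OF _ L2_norm_nonneg])
      have "4 * sinh (2 * \<kappa> * \<delta>) / \<kappa> = 2 * L * sinh (4 * pi * real m * \<delta> / L) / (pi * real m)"
        using L m by (simp add: \<kappa>_def field_simps)
      then show "L2_norm h \<le> ?H" using h(2) by (simp add: C_def)
    qed
    finally have 1: "cmod (LINT v|lborel. g v * k n v) \<le> L2_norm g * ?H + V n * (LINT v|lborel. cmod (g v))" by simp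
    let ?A = "I n - near"
    let ?p = "\<lambda>v. indicator {- (L / 2)..L / 2} v * (\<Sum>l\<in>?A. of_real (c l) * e l v)"
    have fin: "finite ?A" by (simp add: I_def)
    have p: "in_L2 ?p" "(L2_norm ?p)\<^sup>2 = L * (\<Sum>l\<in>?A. (c l)\<^sup>2)"
      using trig_polynomial_L2[OF L fin, of c] unfolding e_def by blast+
    have "(\<Sum>l\<in>?A. of_real (c l) * f (of_int l / L)) = (LINT v|lborel. (\<Sum>l\<in>?A. of_real (c l) * (g v * e l v)))"
      unfolding fl using ge by (simp add: Bochner_Integration.integral_sum)
    also have "\<dots> = (LINT v|lborel. g v * ?p v)"
    proof (intro Bochner_Integration.integral_cong refl)
      fix v show "(\<Sum>l\<in>?A. of_real (c l) * (g v * e l v)) = g v * ?p v"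
      proof (cases "v \<in> {- \<delta>..\<delta>}")
        case True
        then have "v \<in> {- (L / 2)..L / 2}" using \<delta> by auto
        then show ?thesis by (simp add: sum_distrib_left mult_ac)
      qed (simp add: g(3))
    qed
    finally have "cmod (\<Sum>l\<in>?A. of_real (c l) * f (of_int l / L)) \<le> L2_norm g * L2_norm ?p"
      using L2_Cauchy_Schwarz[OF g(1) p(1)] by simp
    also have "L2_norm ?p \<le> ?T"
    proof (rule power2_le_imp_le)
      have "(\<Sum>l\<in>?A. (c l)\<^sup>2) \<le> (\<Sum>l\<in>?A. (1 / (pi * real m))\<^sup>2 * exp (- (x - of_int l)\<^sup>2 / s\<^sup>2))"
      proof (rule sum_mono)
        fix l assume "l \<in> ?A"
        then have far: "real m < \<bar>x - of_int l\<bar>" by (auto simp: near_def)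
        then have "\<bar>sinc (pi * (x - of_int l))\<bar> \<le> 1 / (pi * real m)"
          using m by (auto simp: abs_mult intro!: frac_le)
        then have "(sinc (pi * (x - of_int l)))\<^sup>2 \<le> (1 / (pi * real m))\<^sup>2"
          by (simp only: abs_le_square_iff[symmetric])
        moreover have "(exp (- (x - of_int l)\<^sup>2 / (2 * s\<^sup>2)))\<^sup>2 = exp (- (x - of_int l)\<^sup>2 / s\<^sup>2)"
          by (simp flip: exp_of_nat_mult)
        ultimately show "(c l)\<^sup>2 \<le> (1 / (pi * real m))\<^sup>2 * exp (- (x - of_int l)\<^sup>2 / s\<^sup>2)"
          unfolding c_def power_mult_distrib by (simp only: mult_right_mono exp_ge_zero)
      qed
      also have "\<dots> \<le> (1 / (pi * real m))\<^sup>2 * (exp (- (real m)\<^sup>2 / s\<^sup>2) * (1 + s\<^sup>2 / real m))"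
        unfolding sum_distrib_left[symmetric] using m
        by (intro mult_left_mono gaussian_far_sum_le[OF s _ fin]) (auto simp: near_def)
      finally have "L * (\<Sum>l\<in>?A. (c l)\<^sup>2) \<le> L * \<dots>" using L by (intro mult_left_mono) auto
      also have "\<dots> = ?T\<^sup>2"
        using L m by (simp add: power_divide power_mult_distrib)
      finally show "(L2_norm ?p)\<^sup>2 \<le> ?T\<^sup>2" unfolding p(2) .
      show "0 \<le> ?T" using L by simp
    qed
    finally have 2: "cmod (\<Sum>l\<in>?A. of_real (c l) * f (of_int l / L)) \<le> L2_norm g * ?T"
      by (simp add: mult_left_mono L2_norm_nonneg)
    show ?thesis using dec 1 2 by (simp add: distrib_left)
  qed
  have "V \<longlonglongrightarrow> 0" unfolding V_def using m by real_asymp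
  then have "(\<lambda>n. L2_norm g * (?H + ?T) + V n * (LINT v|lborel. cmod (g v)))
      \<longlonglongrightarrow> L2_norm g * (?H + ?T) + 0 * (LINT v|lborel. cmod (g v))"
    by (intro tendsto_intros)
  then have "cmod (f t - reg_shannon (gauss_window \<sigma>) L m f t)
     \<le> L2_norm g * (?H + ?T) + 0 * (LINT v|lborel. cmod (g v))"
  proof (rule LIMSEQ_le_const)
    show "\<exists>N. \<forall>n\<ge>N. cmod (f t - reg_shannon (gauss_window \<sigma>) L m f t)
        \<le> L2_norm g * (?H + ?T) + V n * (LINT v|lborel. cmod (g v))"
    proof (intro exI allI impI main)
      fix n assume "nat \<lceil>\<bar>x\<bar> + real m\<rceil> \<le> n"
      then show "\<bar>x\<bar> + real m \<le> real n" by linarith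
    qed
  qed
  then show ?thesis by simp
qed

section \<open>The constants\<close>

text \<open>
  With \<open>r = 2 * sqrt (pi * m * z)\<close> the numerator \<open>a\<close> of the first fraction is at most \<open>2 * r\<close> and at most
  \<open>sqrt 2\<close>, hence at most \<open>r + sqrt 2 / 2\<close>.  The rest is arithmetic: \<open>sqrt 2 / 2 + sqrt (pi + 1)\<close> is
  less than 2.75, which leaves room below \<open>m + 1 \<ge> 3\<close> for the factor \<open>1 / (1 - exp (- 2 * pi * m))\<close>.
\<close>
lemma gauss_shannon_constants:
  fixes z :: real and m :: nat
  assumes m: "m \<ge> 2" and z: "0 \<le> z"
  shows "sqrt (2 * (1 - exp (- (8 * pi * real m * z)))) / (1 - exp (- (2 * pi * real m))) + sqrt (pi * (1 - 2 * z) + 1)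
       \<le> 2 * sqrt (pi * real m * z) + (real m + 1)"
proof -
  define r where "r = 2 * sqrt (pi * real m * z)"
  have r: "0 \<le> r" "r\<^sup>2 = 4 * (pi * real m * z)" using z by (auto simp: r_def power_mult_distrib)
  define a where "a = sqrt (2 * (1 - exp (- (8 * pi * real m * z))))"
  have "1 - exp (- (2 * r\<^sup>2)) \<le> 2 * r\<^sup>2" using exp_ge_add_one_self[of "- (2 * r\<^sup>2)"] by linarith
  then have "a\<^sup>2 \<le> (2 * r)\<^sup>2" using z unfolding a_def r(2) by (simp add: mult.assoc power_mult_distrib r(2))
  then have a1: "a \<le> 2 * r" by (rule power2_le_imp_le) (use r in simp)
  \<comment> \<open>The number 1.42 exceeds \<open>sqrt 2\<close>.\<close>
  have a2: "a \<le> 142 / 100" unfolding a_def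
  proof (rule real_le_lsqrt)
    have "2 * (1 - exp (- (8 * pi * real m * z))) \<le> 2" by simp
    also have "(2::real) \<le> (142 / 100)\<^sup>2" by (simp add: power2_eq_square)
    finally show "2 * (1 - exp (- (8 * pi * real m * z))) \<le> (142 / 100)\<^sup>2" .
  qed (use z in auto)
  have a0: "0 \<le> a" using z by (simp add: a_def)
  \<comment> \<open>From \<open>pi > 3\<close> and \<open>m \<ge> 2\<close>; the fraction then exceeds \<open>a\<close> by at most \<open>a / 12\<close>.\<close>
  have "13 \<le> 1 + 2 * pi * real m"
    using mult_mono[of 3 pi 2 "real m"] pi_gt3 m by simp
  also have "\<dots> \<le> exp (2 * pi * real m)" by (rule exp_ge_add_one_self)
  finally have "exp (- (2 * pi * real m)) \<le> 1 / 13" by (simp add: exp_minus field_simps)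
  then have "a / (1 - exp (- (2 * pi * real m))) \<le> a / (1 - 1 / 13)"
    using a0 m by (intro divide_left_mono) auto
  also have "\<dots> \<le> a + 12 / 100" using a2 by simp
  also have "\<dots> \<le> r + 83 / 100" using a1 a2 by linarith
  finally have "a / (1 - exp (- (2 * pi * real m))) \<le> r + 83 / 100" .
  moreover have "sqrt (pi * (1 - 2 * z) + 1) \<le> 205 / 100"
  proof (rule real_le_lsqrt)
    have "pi * (1 - 2 * z) \<le> pi * 1" using z by (intro mult_left_mono) auto
    also have "\<dots> \<le> 3.2" using pi_less_4 pi_approx by simp
    finally show "pi * (1 - 2 * z) + 1 \<le> (205 / 100)\<^sup>2" by (simp add: power2_eq_square)
  qed auto
  ultimately show ?thesis using m unfolding a_def[symmetric] r_def[symmetric] by linarith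
qed

text \<open>
  For the prescribed \<open>\<sigma>\<close> one has \<open>s\<^sup>2 = m * L / (pi * (L - 2 * \<delta>))\<close>, and both summands as well as the right-hand
  side are multiples of \<open>K = exp (- a) * L / (pi * m * sqrt (pi * (L - 2 * \<delta>)))\<close>, where \<open>- a\<close> is the exponent of
  the claim.  Cancelling \<open>K\<close> leaves an inequality in \<open>m\<close> and \<open>z = \<delta> / L\<close>.
\<close>
lemma gauss_shannon_error_constant:
  fixes \<delta> L \<sigma> :: real and m :: nat
  assumes \<delta>: "0 \<le> \<delta>" "2 * \<delta> < L" and m: "m \<ge> 2"
    and \<sigma>: "\<sigma> = sqrt (real m / (pi * L * (L - 2 * \<delta>)))"
  defines "s \<equiv> \<sigma> * L"
  shows "s / (sqrt (2 * pi) * real m * sinh (pi * real m)) * exp ((real m)\<^sup>2 / (2 * s\<^sup>2)) *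
           sqrt (2 * L * sinh (4 * pi * real m * \<delta> / L) / (pi * real m))
         + sqrt (L * (exp (- (real m)\<^sup>2 / s\<^sup>2) * (1 + s\<^sup>2 / real m))) / (pi * real m)
       \<le> (2 * sqrt (pi * \<delta> * L) + L * (real m + 1) / sqrt (real m))
          / (pi * sqrt (real m * pi * (L - 2 * \<delta>)))
        * exp (- (pi * real m * (L / 2 - \<delta>) / L))"
    (is "?H + ?T \<le> ?R")
proof -
  define M where "M = real m"
  define P where "P = pi * (L - 2 * \<delta>)"
  define z where "z = \<delta> / L"
  define a where "a = pi * M * (L / 2 - \<delta>) / L"
  define w where "w = exp (- (8 * pi * M * z))"
  define \<epsilon> where "\<epsilon> = exp (- (2 * pi * M))"
  define K where "K = exp (- a) * L / (pi * M * sqrt P)"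
  have L: "L > 0" using \<delta> by linarith
  have M: "M > 0" using m by (simp add: M_def)
  have P: "P > 0" using \<delta> by (simp add: P_def)
  have z: "0 \<le> z" using \<delta> L by (simp add: z_def)
  have \<delta>z: "\<delta> = L * z" using L by (simp add: z_def)
  have s2: "s\<^sup>2 = M * L / P"
    using L M P unfolding s_def \<sigma> M_def[symmetric] P_def
    by (simp add: power_mult_distrib power2_eq_square field_simps)
  have s: "s > 0" using L M P unfolding s_def \<sigma> M_def[symmetric] P_def
    by (auto intro!: mult_pos_pos divide_pos_pos simp: zero_less_mult_iff)
  have ma: "M\<^sup>2 / s\<^sup>2 = 2 * a"
    using L M P unfolding s2 a_def P_def by (simp add: power2_eq_square field_simps)
  have \<epsilon>: "\<epsilon> < 1" using M by (simp add: \<epsilon>_def)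
  have w: "0 < w" "w \<le> 1" using M z by (auto simp: w_def)
  have K: "K \<ge> 0" using L M P by (simp add: K_def)
  have sinh1: "sinh (pi * M) = exp (pi * M) * (1 - \<epsilon>) / 2"
    by (simp add: sinh_def \<epsilon>_def right_diff_distrib flip: exp_add)
  have sinh2: "sinh (4 * pi * M * \<delta> / L) = exp (4 * pi * M * z) * (1 - w) / 2"
    using L by (simp add: sinh_def w_def \<delta>z right_diff_distrib mult_ac flip: exp_add)
  \<comment> \<open>The growth of the Gaussian at height \<open>m\<close>, of the exponential at the band edge and of \<open>sinh (pi * m)\<close> combine
    to the exponential of the claim.\<close>
  have expo: "exp (2 * a) * exp (4 * pi * M * z) = (exp (- a))\<^sup>2 * (exp (pi * M))\<^sup>2"
  proof -
    have "2 * a + 4 * pi * M * z = 2 * (- a) + 2 * (pi * M)"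
      using L by (simp add: a_def \<delta>z field_simps)
    then have "exp (2 * a + 4 * pi * M * z) = exp (2 * (- a) + 2 * (pi * M))" by (simp only:)
    then show ?thesis by (simp only: exp_add exp_double)
  qed
  have H: "?H = K * (sqrt (2 * (1 - w)) / (1 - \<epsilon>))"
  proof (rule power2_eq_imp_eq)
    have "?H\<^sup>2 = s\<^sup>2 / (2 * pi * M\<^sup>2 * (sinh (pi * M))\<^sup>2) * (exp (M\<^sup>2 / (2 * s\<^sup>2)))\<^sup>2 *
        (2 * L * sinh (4 * pi * M * \<delta> / L) / (pi * M))"
      using L M \<delta> unfolding M_def[symmetric] by (simp add: power_mult_distrib power_divide)
    also have "(exp (M\<^sup>2 / (2 * s\<^sup>2)))\<^sup>2 = exp (2 * a)"
      unfolding ma[symmetric] by (simp flip: exp_of_nat_mult)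
    also have "s\<^sup>2 / (2 * pi * M\<^sup>2 * (sinh (pi * M))\<^sup>2) * exp (2 * a) * (2 * L * sinh (4 * pi * M * \<delta> / L) / (pi * M))
       = L\<^sup>2 * (2 * (1 - w)) / (pi\<^sup>2 * M\<^sup>2 * P * (1 - \<epsilon>)\<^sup>2) * (exp (2 * a) * exp (4 * pi * M * z)) / (exp (pi * M))\<^sup>2"
      unfolding s2 sinh1 sinh2 using M P \<epsilon> by (simp add: power2_eq_square divide_simps)
    also have "\<dots> = L\<^sup>2 * (2 * (1 - w)) / (pi\<^sup>2 * M\<^sup>2 * P * (1 - \<epsilon>)\<^sup>2) * (exp (- a))\<^sup>2"
      unfolding expo by simp
    also have "\<dots> = (K * (sqrt (2 * (1 - w)) / (1 - \<epsilon>)))\<^sup>2"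
      using w P unfolding K_def by (simp add: power_mult_distrib power_divide)
    finally show "?H\<^sup>2 = (K * (sqrt (2 * (1 - w)) / (1 - \<epsilon>)))\<^sup>2" .
    show "0 \<le> ?H" using s M L \<delta> unfolding M_def[symmetric] by simp
    show "0 \<le> K * (sqrt (2 * (1 - w)) / (1 - \<epsilon>))" using K w \<epsilon> by simp
  qed
  have T: "?T = K * sqrt (pi * (1 - 2 * z) + 1)"
  proof (rule power2_eq_imp_eq)
    have pz: "0 \<le> pi * (1 - 2 * z) + 1"
    proof -
      have "0 \<le> 1 - 2 * z" using \<delta> L by (simp add: z_def field_simps)
      then show ?thesis by simp
    qed
    have "- M\<^sup>2 / s\<^sup>2 = - (2 * a)" using ma by simp
    then have "?T\<^sup>2 = L * (exp (- (2 * a)) * (1 + s\<^sup>2 / M)) / (pi * M)\<^sup>2"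
      using L M unfolding M_def[symmetric] by (simp add: power_divide)
    also have "\<dots> = (exp (- a))\<^sup>2 * (L * (P + L)) / ((pi * M)\<^sup>2 * P)"
      unfolding s2 using M P by (simp add: divide_simps) (simp add: algebra_simps flip: exp_of_nat_mult)
    also have "L * (P + L) = L\<^sup>2 * (pi * (1 - 2 * z) + 1)"
      unfolding P_def \<delta>z by (simp add: power2_eq_square algebra_simps)
    also have "(exp (- a))\<^sup>2 * (L\<^sup>2 * (pi * (1 - 2 * z) + 1)) / ((pi * M)\<^sup>2 * P) = (K * sqrt (pi * (1 - 2 * z) + 1))\<^sup>2"
      using pz P unfolding K_def by (simp add: power_mult_distrib power_divide)
    finally show "?T\<^sup>2 = (K * sqrt (pi * (1 - 2 * z) + 1))\<^sup>2" .
    show "0 \<le> ?T" using L M unfolding M_def[symmetric] by simp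
    show "0 \<le> K * sqrt (pi * (1 - 2 * z) + 1)" using K pz by simp
  qed
  have R: "?R = K * (2 * sqrt (pi * M * z) + (M + 1))"
  proof -
    have "sqrt (pi * \<delta> * L) = L * sqrt (pi * z)"
      using L by (simp add: \<delta>z real_sqrt_mult)
    moreover have "sqrt (M * pi * (L - 2 * \<delta>)) = sqrt M * sqrt P"
      unfolding P_def by (simp add: real_sqrt_mult)
    moreover have "sqrt (pi * M * z) = sqrt M * sqrt (pi * z)" by (simp add: real_sqrt_mult)
    moreover have "(2 * (L * y) + L * (M + 1) / r) / (pi * (r * p)) * E
        = E * L / (pi * (r * r) * p) * (2 * (r * y) + (M + 1))" if "r > 0" for r y p E
      using that by (simp add: divide_simps) (simp add: algebra_simps)
    from this[of "sqrt M"] have "(2 * (L * y) + L * (M + 1) / sqrt M) / (pi * (sqrt M * p)) * E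
        = E * L / (pi * M * p) * (2 * (sqrt M * y) + (M + 1))" for y p E using M by simp
    ultimately show ?thesis
      unfolding K_def a_def M_def[symmetric] by (simp only:)
  qed
  have "sqrt (2 * (1 - w)) / (1 - \<epsilon>) + sqrt (pi * (1 - 2 * z) + 1) \<le> 2 * sqrt (pi * M * z) + (M + 1)"
    using gauss_shannon_constants[OF m z] unfolding w_def \<epsilon>_def M_def .
  from mult_left_mono[OF this K] show ?thesis
    unfolding H T R by (simp add: distrib_left)
qed

section \<open>Continuity and decay at infinity\<close>

text \<open>
  Decay at infinity confines the supremum to a compact interval, so it is attained; only then does the
  operator \<open>GREATEST\<close> denote it.
\<close>
lemma C0_norm_le:
  assumes g: "g \<in> C0_space" and B: "\<And>t. cmod (g t) \<le> B"
  shows "C0_norm g \<le> B"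
proof -
  have "\<exists>t0. \<forall>t. cmod (g t) \<le> cmod (g t0)"
  proof (cases "\<exists>t1. g t1 \<noteq> 0")
    case True
    then obtain t1 where t1: "0 < cmod (g t1)" by auto
    have "(g \<longlongrightarrow> 0) at_infinity" using g by (simp add: C0_space_def)
    from tendstoD[OF this t1] obtain b where b: "\<And>t. b \<le> \<bar>t\<bar> \<Longrightarrow> cmod (g t) < cmod (g t1)"
      by (auto simp: eventually_at_infinity)
    define S where "S = {- max \<bar>b\<bar> \<bar>t1\<bar>..max \<bar>b\<bar> \<bar>t1\<bar>}"
    have t1S: "t1 \<in> S" by (auto simp: S_def)
    have "continuous_on S (\<lambda>t. cmod (g t))"
      using g by (auto simp: C0_space_def intro!: continuous_intros intro: continuous_on_subset)
    then have "\<exists>t0\<in>S. \<forall>t\<in>S. cmod (g t) \<le> cmod (g t0)"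
      using t1S by (intro continuous_attains_sup) (auto simp: S_def)
    then obtain t0 where t0: "\<And>t. t \<in> S \<Longrightarrow> cmod (g t) \<le> cmod (g t0)" by blast
    have "cmod (g t) \<le> cmod (g t0)" for t
    proof (cases "t \<in> S")
      case False
      then have "b \<le> \<bar>t\<bar>" by (auto simp: S_def)
      then show ?thesis using b[of t] t0[OF t1S] by linarith
    qed (rule t0)
    then show ?thesis by blast
  qed auto
  then obtain t0 where t0: "\<And>t. cmod (g t) \<le> cmod (g t0)" by blast
  have "C0_norm g = cmod (g t0)"
    unfolding C0_norm_def by (rule Greatest_equality) (use t0 in auto)
  then show ?thesis using B by simp
qed

text \<open>
  If \<open>\<bar>f t\<bar> \<ge> e\<close> then \<open>\<bar>f\<bar> \<ge> e / 2\<close> on an interval around \<open>t\<close> whose length does not depend on \<open>t\<close>.  Far out this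
  contradicts the smallness of the tail of the integral of \<open>\<bar>f\<bar>\<^sup>2\<close>.
\<close>
lemma in_L2_Lipschitz_vanishes_at_infinity:
  assumes f: "in_L2 f" and lip: "\<And>t u. cmod (f t - f u) \<le> K * \<bar>t - u\<bar>"
  shows "(f \<longlongrightarrow> 0) at_infinity"
proof (rule tendstoI)
  fix e :: real assume e: "e > 0"
  have K: "0 \<le> K" using order_trans[OF norm_ge_zero lip[of 1 0]] by simp
  define \<eta> where "\<eta> = e / (2 * (K + 1))"
  have \<eta>: "\<eta> > 0" "K * \<eta> \<le> e / 2"
    using e K by (auto simp: \<eta>_def field_simps intro!: mult_left_le)
  let ?q = "\<lambda>t. (cmod (f t))\<^sup>2"
  let ?tail = "\<lambda>n::nat. LINT t|lborel. indicator {t. real n \<le> \<bar>t\<bar>} t * ?q t"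
  have [measurable]: "f \<in> borel_measurable borel" using f by (rule in_L2D)
  have q: "integrable lborel ?q" using f by (rule in_L2D)
  have tint: "integrable lborel (\<lambda>t. indicator {t. real n \<le> \<bar>t\<bar>} t * ?q t)" for n
    by (rule Bochner_Integration.integrable_bound[OF q]) (auto simp: indicator_def)
  have "?tail \<longlonglongrightarrow> (LINT (t::real)|lborel. (0::real))"
  proof (rule integral_dominated_convergence[where w = ?q and f = "\<lambda>_. 0"
        and s = "\<lambda>n t. indicator {t. real n \<le> \<bar>t\<bar>} t * ?q t"])
    show "AE t in lborel. (\<lambda>n. indicator {t. real n \<le> \<bar>t\<bar>} t * ?q t) \<longlonglongrightarrow> 0"
    proof (rule AE_I2, rule tendsto_eventually)
      fix t :: real
      show "\<forall>\<^sub>F n in sequentially. indicator {t. real n \<le> \<bar>t\<bar>} t * ?q t = 0"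
        using eventually_gt_at_top[of "nat \<lceil>\<bar>t\<bar>\<rceil>"]
        by eventually_elim (auto simp: indicator_def, linarith)
    qed
  qed (use q in \<open>auto simp: indicator_def\<close>)
  then have "\<forall>\<^sub>F n in sequentially. ?tail n < 2 * \<eta> * (e / 2)\<^sup>2"
    using e \<eta> by (intro order_tendstoD(2)) auto
  then obtain n where n: "?tail n < 2 * \<eta> * (e / 2)\<^sup>2"
    by (auto simp: eventually_sequentially)
  have "cmod (f t) < e" if t: "real n + \<eta> \<le> \<bar>t\<bar>" for t
  proof (rule ccontr)
    assume "\<not> cmod (f t) < e"
    then have ft: "e \<le> cmod (f t)" by simp
    have "indicator {t - \<eta>..t + \<eta>} x * (e / 2)\<^sup>2 \<le> indicator {t. real n \<le> \<bar>t\<bar>} x * ?q x" for x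
    proof (cases "x \<in> {t - \<eta>..t + \<eta>}")
      case True
      then have tx: "\<bar>t - x\<bar> \<le> \<eta>" by auto
      have "cmod (f t - f x) \<le> K * \<eta>" using lip[of t x] mult_left_mono[OF tx K] by linarith
      then have "e / 2 \<le> cmod (f x)" using ft \<eta>(2) norm_triangle_ineq2[of "f t" "f x"] by linarith
      then have "(e / 2)\<^sup>2 \<le> ?q x" using e by (intro power_mono) auto
      moreover have "real n \<le> \<bar>x\<bar>" using t tx by linarith
      ultimately show ?thesis using True by simp
    qed simp
    then have "(LINT x|lborel. indicator {t - \<eta>..t + \<eta>} x * (e / 2)\<^sup>2) \<le> ?tail n"
      using \<eta> by (intro integral_mono tint) auto
    then show False using n \<eta> by simp
  qed
  then show "\<forall>\<^sub>F t in at_infinity. dist (f t) 0 < e"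
    unfolding eventually_at_infinity by auto
qed

text \<open>
  Frequencies are bounded by \<open>\<delta>\<close> on the support of \<open>g\<close>, which makes \<open>f\<close> Lipschitz continuous.
\<close>
lemma bandlimited_vanishes_at_infinity:
  assumes f: "in_L2 f" and g: "integrable lborel g" "\<And>v. v \<notin> {- \<delta>..\<delta>} \<Longrightarrow> g v = 0"
    and fg: "\<And>t. f t = (LINT v|lborel. g v * cis (2 * pi * t * v))"
  shows "(f \<longlongrightarrow> 0) at_infinity"
proof (rule in_L2_Lipschitz_vanishes_at_infinity[OF f])
  fix t u :: real
  have [measurable]: "g \<in> borel_measurable borel" using borel_measurable_integrable[OF g(1)] by simp
  have i: "integrable lborel (\<lambda>v. g v * cis (2 * pi * t * v))" for t
    by (rule Bochner_Integration.integrable_bound[OF g(1)]) (auto simp: norm_mult)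
  have cis_lip: "cmod (cis a - cis b) \<le> \<bar>a - b\<bar>" for a b
  proof -
    have "cis a - cis b = cis b * (cis (a - b) - 1)" by (simp add: right_diff_distrib cis_mult)
    then have "cmod (cis a - cis b) = cmod (exp (\<i> * of_real (a - b)) - 1)"
      by (simp add: norm_mult cis_conv_exp)
    then show ?thesis using iexp_approx1[of "a - b" 0] by simp
  qed
  have "cmod (f t - f u) = cmod (LINT v|lborel. g v * cis (2 * pi * t * v) - g v * cis (2 * pi * u * v))"
    unfolding fg using i by simp
  also have "\<dots> \<le> (LINT v|lborel. 2 * pi * \<bar>\<delta>\<bar> * \<bar>t - u\<bar> * cmod (g v))"
  proof (rule order_trans[OF integral_norm_bound integral_mono])
    fix v
    show "norm (g v * cis (2 * pi * t * v) - g v * cis (2 * pi * u * v)) \<le> 2 * pi * \<bar>\<delta>\<bar> * \<bar>t - u\<bar> * cmod (g v)"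
    proof (cases "v \<in> {- \<delta>..\<delta>}")
      case True
      have "norm (g v * cis (2 * pi * t * v) - g v * cis (2 * pi * u * v))
         = cmod (g v) * cmod (cis (2 * pi * t * v) - cis (2 * pi * u * v))"
        by (simp add: norm_mult flip: right_diff_distrib)
      also have "\<dots> \<le> cmod (g v) * \<bar>2 * pi * t * v - 2 * pi * u * v\<bar>"
        by (intro mult_left_mono cis_lip) auto
      also have "\<bar>2 * pi * t * v - 2 * pi * u * v\<bar> = 2 * pi * \<bar>v\<bar> * \<bar>t - u\<bar>"
        by (simp add: abs_mult flip: left_diff_distrib right_diff_distrib)
      also have "cmod (g v) * \<dots> \<le> cmod (g v) * (2 * pi * \<bar>\<delta>\<bar> * \<bar>t - u\<bar>)"
        using True by (intro mult_left_mono mult_right_mono) auto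
      finally show ?thesis by (simp add: mult_ac)
    qed (simp add: g(2))
  qed (use g i in auto)
  also have "\<dots> = 2 * pi * \<bar>\<delta>\<bar> * (LINT v|lborel. cmod (g v)) * \<bar>t - u\<bar>"
    by (simp add: mult_ac)
  finally show "cmod (f t - f u) \<le> 2 * pi * \<bar>\<delta>\<bar> * (LINT v|lborel. cmod (g v)) * \<bar>t - u\<bar>" .
qed

text \<open>
  The cut-off points \<open>\<plusminus> m / L\<close> are zeros of the sinc function, so truncation causes no jump.
\<close>
lemma continuous_on_truncated_sinc_window:
  assumes \<phi>: "continuous_on UNIV \<phi>" and L: "L > 0" and m: "m \<ge> 1"
  shows "continuous_on UNIV (\<lambda>u. sinc (L * pi * u) * \<phi> u * indicator {- (real m / L)..real m / L} u)"
proof -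
  have "continuous_on UNIV (\<lambda>u. if \<bar>u\<bar> \<le> real m / L then sinc (L * pi * u) * \<phi> u else 0)"
  proof (rule continuous_on_cases_le)
    show "continuous_on {u \<in> UNIV. \<bar>u\<bar> \<le> real m / L} (\<lambda>u. sinc (L * pi * u) * \<phi> u)"
      using \<phi> by (intro continuous_on_mult continuous_on_sinc continuous_on_const continuous_on_id)
        (auto intro: continuous_on_subset)
    fix u :: real assume "\<bar>u\<bar> = real m / L"
    then have "\<bar>L * u\<bar> = real m" using L by (simp add: abs_mult field_simps)
    then have "L * u = real m \<or> L * u = - real m" by linarith
    then have "sin ((L * u) * pi) = 0"
    proof (elim disjE)
      assume Lu: "L * u = real m" show ?thesis unfolding Lu by simp
    next
      assume Lu: "L * u = - real m" show ?thesis unfolding Lu by simp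
    qed
    then have "sin (L * pi * u) = 0" by (simp add: mult_ac)
    moreover have "L * pi * u \<noteq> 0" using \<open>\<bar>u\<bar> = real m / L\<close> L m by auto
    ultimately show "sinc (L * pi * u) * \<phi> u = 0" by simp
  qed (auto intro!: continuous_intros)
  also have "(\<lambda>u. if \<bar>u\<bar> \<le> real m / L then sinc (L * pi * u) * \<phi> u else 0)
      = (\<lambda>u. sinc (L * pi * u) * \<phi> u * indicator {- (real m / L)..real m / L} u)"
    by (auto simp: fun_eq_iff indicator_def abs_le_iff)
  finally show ?thesis .
qed

lemma continuous_on_reg_shannon:
  assumes \<phi>: "continuous_on UNIV \<phi>" and L: "L > 0" and m: "m \<ge> 1"
  shows "continuous_on UNIV (reg_shannon \<phi> L m f)"
proof (intro continuous_at_imp_continuous_on ballI)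
  fix t0 :: real
  \<comment> \<open>These samples cover the window of every \<open>t\<close> with \<open>\<bar>t - t0\<bar> < 1\<close>.\<close>
  define J where "J = {l::int. \<bar>L * t0 - of_int l\<bar> \<le> real m + L}"
  let ?\<psi> = "\<lambda>u. sinc (L * pi * u) * \<phi> u * indicator {- (real m / L)..real m / L} u"
  have eq: "reg_shannon \<phi> L m f t = (\<Sum>l\<in>J. f (of_int l / L) * of_real (?\<psi> (t - of_int l / L)))"
    if "t \<in> ball t0 1" for t
  proof (rule reg_shannon_eq_sum_superset[OF L])
    show "finite J" unfolding J_def by (rule finite_near_ints)
    have "\<bar>L * t0 - L * t\<bar> = L * \<bar>t0 - t\<bar>" using L by (simp add: abs_mult flip: right_diff_distrib)
    also have "\<dots> \<le> L * 1" using that L by (intro mult_left_mono) (auto simp: dist_real_def)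
    finally show "{l. \<bar>L * t - of_int l\<bar> \<le> real m} \<subseteq> J" unfolding J_def by auto
  qed
  have "continuous_on (ball t0 1) (\<lambda>t. \<Sum>l\<in>J. f (of_int l / L) * of_real (?\<psi> (t - of_int l / L)))"
    by (intro continuous_on_sum continuous_on_mult continuous_on_const continuous_on_of_real
        continuous_on_compose2[OF continuous_on_truncated_sinc_window[OF \<phi> L m]] continuous_on_diff continuous_on_id) auto
  then have "continuous_on (ball t0 1) (reg_shannon \<phi> L m f)"
    by (rule continuous_on_eq) (simp only: eq)
  then show "isCont (reg_shannon \<phi> L m f) t0"
    by (rule continuous_on_interior) simp
qed

text \<open>
  The number of samples that contribute at \<open>t\<close> is bounded, and all of them move to infinity with \<open>t\<close>.  Indexing them
  by their offset \<open>j\<close> from \<open>\<lfloor>L * t\<rfloor>\<close> gives a sum over a set that does not depend on \<open>t\<close>.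
\<close>
lemma reg_shannon_vanishes_at_infinity:
  assumes f: "(f \<longlongrightarrow> 0) at_infinity" and \<phi>: "\<And>u. \<bar>\<phi> u\<bar> \<le> 1" and L: "L > 0"
  shows "(reg_shannon \<phi> L m f \<longlongrightarrow> 0) at_infinity"
proof -
  define p where "p = (\<lambda>(j::int) t. of_int (\<lfloor>L * t\<rfloor> + j) / L)"
  define J where "J = {- int m..int m + 1}"
  let ?\<psi> = "\<lambda>u. sinc (L * pi * u) * \<phi> u * indicator {- (real m / L)..real m / L} u"
  have psi: "\<bar>?\<psi> u\<bar> \<le> 1" for u
  proof -
    have sinc_le: "\<bar>sinc v\<bar> \<le> 1" for v
      using abs_sin_x_le_abs_x[of v] by (auto simp: abs_divide divide_le_eq)
    have "\<bar>indicat_real A u\<bar> \<le> 1" for A by (simp add: indicator_def)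
    then show ?thesis
      unfolding abs_mult by (intro mult_le_one \<phi> sinc_le mult_nonneg_nonneg abs_ge_zero)
  qed
  have p: "filterlim (p j) at_infinity at_infinity" for j
  proof (rule filterlim_at_infinity[THEN iffD2, OF order_refl], intro allI impI)
    fix r :: real
    show "\<forall>\<^sub>F t in at_infinity. r \<le> norm (p j t)"
      unfolding eventually_at_infinity
    proof (intro exI allI impI)
      fix t :: real assume t: "r + (1 + \<bar>of_int j\<bar>) / L \<le> norm t"
      have "t - p j t = (L * t - of_int \<lfloor>L * t\<rfloor> - of_int j) / L"
        using L by (simp add: p_def field_simps)
      moreover have "\<bar>L * t - of_int \<lfloor>L * t\<rfloor> - of_int j\<bar> \<le> 1 + \<bar>of_int j\<bar>" by linarith
      ultimately have "\<bar>t - p j t\<bar> \<le> (1 + \<bar>of_int j\<bar>) / L"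
        using L by (simp add: abs_divide divide_right_mono)
      then show "r \<le> norm (p j t)" using t by simp
    qed
  qed
  have bound: "cmod (reg_shannon \<phi> L m f t) \<le> (\<Sum>j\<in>J. cmod (f (p j t)))" for t
  proof -
    have "reg_shannon \<phi> L m f t
      = (\<Sum>l\<in>(\<lambda>j. \<lfloor>L * t\<rfloor> + j) ` J. f (of_int l / L) * of_real (?\<psi> (t - of_int l / L)))"
    proof (rule reg_shannon_eq_sum_superset[OF L])
      show "{l. \<bar>L * t - of_int l\<bar> \<le> real m} \<subseteq> (\<lambda>j. \<lfloor>L * t\<rfloor> + j) ` J"
      proof
        fix l assume "l \<in> {l. \<bar>L * t - of_int l\<bar> \<le> real m}"
        then have "l - \<lfloor>L * t\<rfloor> \<in> J" unfolding J_def by (simp add: abs_le_iff) linarith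
        then show "l \<in> (\<lambda>j. \<lfloor>L * t\<rfloor> + j) ` J" by (rule rev_image_eqI) simp
      qed
    qed (simp add: J_def)
    also have "\<dots> = (\<Sum>j\<in>J. f (p j t) * of_real (?\<psi> (t - p j t)))"
      by (subst sum.reindex, simp add: inj_on_def, simp only: o_def p_def)
    finally have eq: "reg_shannon \<phi> L m f t = (\<Sum>j\<in>J. f (p j t) * of_real (?\<psi> (t - p j t)))" .
    show ?thesis
      unfolding eq
    proof (rule order_trans[OF norm_sum sum_mono])
      fix j show "cmod (f (p j t) * of_real (?\<psi> (t - p j t))) \<le> cmod (f (p j t))"
        unfolding norm_mult[of "f (p j t)"] norm_of_real by (intro mult_left_le psi) auto
    qed
  qed
  have "((\<lambda>t. \<Sum>j\<in>J. cmod (f (p j t))) \<longlongrightarrow> (\<Sum>j\<in>J. cmod 0)) at_infinity"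
    by (intro tendsto_sum tendsto_norm filterlim_compose[OF f p])
  then have "((\<lambda>t. \<Sum>j\<in>J. cmod (f (p j t))) \<longlongrightarrow> 0) at_infinity" by simp
  then show ?thesis
    by (rule Lim_null_comparison[OF always_eventually[OF allI[OF bound]]])
qed

section \<open>The error in the maximum norm\<close>

theorem theorem4p1:
  fixes N m :: nat and \<tau> \<delta> lam L \<sigma> :: real and f :: "real \<Rightarrow> complex"
  assumes "N \<ge> 1"
    and "0 < \<tau>" and "\<tau> < 1 / 2"
    and "\<delta> = \<tau> * real N"
    and "lam \<ge> 0"
    and "L = real N * (1 + lam)"
    and "m \<ge> 2"
    and "f \<in> Paley_Wiener \<delta>"
    and "\<sigma> = sqrt (real m / (pi * L * (L - 2 * \<delta>)))"
  shows "(\<lambda>t. f t - reg_shannon (gauss_window \<sigma>) L m f t) \<in> C0_space \<and>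
    C0_norm (\<lambda>t. f t - reg_shannon (gauss_window \<sigma>) L m f t)
      \<le> (2 * sqrt (pi * \<delta> * L) + L * (real m + 1) / sqrt (real m))
          / (pi * sqrt (real m * pi * (L - 2 * \<delta>)))
        * exp (- (pi * real m * (L / 2 - \<delta>) / L))
        * L2_norm f"
    (is "?err \<in> _ \<and> _ \<le> ?B * _")
proof -
  have \<delta>: "0 \<le> \<delta>" using assms by simp
  have "real N * (2 * \<tau>) < real N * 1" using assms by (intro mult_strict_left_mono) auto
  also have "\<dots> \<le> L" using assms by (simp add: mult_left_mono)
  finally have \<delta>L: "2 * \<delta> < L" using assms(4) by (simp add: mult_ac)
  have L: "L > 0" using \<delta> \<delta>L by linarith
  have \<sigma>: "\<sigma> > 0" using assms(7,9) L \<delta>L by simp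
  have m: "m \<ge> 1" using assms(7) by simp
  from assms(8) obtain g0 where f: "smooth f" "in_L2 f" "has_fourier_L2 f g0" "ess_support g0 \<subseteq> {- \<delta>..\<delta>}"
    by (auto simp: Paley_Wiener_def)
  have cont: "isCont f t" for t
    using f(1)[unfolded smooth_def, rule_format, of 0 t] by (auto intro: differentiable_imp_continuous_within)
  obtain g where g: "in_L2 g" "integrable lborel g" "\<And>v. v \<notin> {- \<delta>..\<delta>} \<Longrightarrow> g v = 0"
    and fg: "\<And>t. f t = (LINT v|lborel. g v * cis (2 * pi * t * v))" and norm: "L2_norm g = L2_norm f"
    by (rule Paley_Wiener_inversion[OF f(2) cont f(3,4)]) (rule that)
  have "continuous_on UNIV (gauss_window \<sigma>)"
    unfolding gauss_window_def using \<sigma> by (intro continuous_intros) auto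
  moreover have "continuous_on UNIV f" using cont by (simp add: continuous_at_imp_continuous_on)
  ultimately have "continuous_on UNIV ?err"
    by (intro continuous_on_diff continuous_on_reg_shannon L m)
  moreover have "(?err \<longlongrightarrow> 0 - 0) at_infinity"
  proof (intro tendsto_diff reg_shannon_vanishes_at_infinity L)
    show "(f \<longlongrightarrow> 0) at_infinity"
      by (rule bandlimited_vanishes_at_infinity[OF f(2) g(2,3) fg])
    then show "(f \<longlongrightarrow> 0) at_infinity" .
    show "\<bar>gauss_window \<sigma> u\<bar> \<le> 1" for u by (simp add: gauss_window_def)
  qed
  ultimately have C0: "?err \<in> C0_space" by (simp add: C0_space_def)
  have "cmod (?err t) \<le> ?B * L2_norm f" for t
  proof -
    have "cmod (?err t) \<le> L2_norm g * ?B"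
      by (rule order_trans[OF gauss_shannon_pointwise_error[OF g fg \<delta> \<delta>L \<sigma> m, of t]
            mult_left_mono[OF gauss_shannon_error_constant[OF \<delta> \<delta>L assms(7,9)] L2_norm_nonneg[of g]]])
    then show ?thesis unfolding norm by (simp only: mult.commute)
  qed
  then show ?thesis using C0 C0_norm_le[OF C0] by blast
qed

end
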